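(* Let $A,B$ be two $n\times n$ Hermitian matrices with eigenvalue decompositions $A=Q\Lambda Q^*$ and $B=VDV^*$ ($Q,V$ unitary), where $\Lambda=\operatorname{diag}(\lambda_1,\dots,\lambda_n)$ and $D=\operatorname{diag}(d_1,\dots,d_n)$ with $\lambda_1\ge\dots\ge\lambda_n$ and $d_1\ge\dots\ge d_n$. Then, for every unitarily invariant norm $|||\cdot|||$ on $\mathbb{C}^{n\times n}$, $$Q\,R_n(\tfrac{\pi}{4})\,V^*\in\operatorname*{arg\,max}_{U\in\mathbf{U}(n)}\;|||\,[A,UBU^*]\,|||.$$
   Context: $\mathbf{U}(n)$ is the set of $n\times n$ unitary matrices and $[X,Y]=XY-YX$. A norm is unitarily invariant if $|||UXV|||=|||X|||$ for all unitary $U,V$. For $\theta\in[0,2\pi)$, the rotation matrix $R_n(\theta)$ is the $n\times n$ real matrix with, for $1\le i\le\lfloor n/2\rfloor$, entries $(i,i)$ and $(n+1-i,n+1-i)$ equal to $\cos\theta$, entry $(i,n+1-i)$ equal to $-\sin\theta$, entry $(n+1-i,i)$ equal to $\sin\theta$; if $n$ is odd its central entry is $1$; all other entries are $0$. *)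

theory Defs
  imports "Jordan_Normal_Form.Schur_Decomposition" Complex_Main
begin

definition hermitian_mat :: "complex mat \<Rightarrow> bool" where
  "hermitian_mat A \<longleftrightarrow> mat_adjoint A = A"

definition unitary_mats :: "nat \<Rightarrow> complex mat set" where
  "unitary_mats n =
     {U \<in> carrier_mat n n. U * mat_adjoint U = 1\<^sub>m n \<and> mat_adjoint U * U = 1\<^sub>m n}"

definition mat_commutator :: "complex mat \<Rightarrow> complex mat \<Rightarrow> complex mat" where
  "mat_commutator X Y = X * Y - Y * X"

(* A norm on the n x n complex matrices; values of N outside carrier_mat n n are irrelevant. *)
definition mat_norm_on :: "nat \<Rightarrow> (complex mat \<Rightarrow> real) \<Rightarrow> bool" where
  "mat_norm_on n N \<longleftrightarrow>
     (\<forall>X \<in> carrier_mat n n. 0 \<le> N X) \<and>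
     (\<forall>X \<in> carrier_mat n n. N X = 0 \<longleftrightarrow> X = 0\<^sub>m n n) \<and>
     (\<forall>c. \<forall>X \<in> carrier_mat n n. N (c \<cdot>\<^sub>m X) = cmod c * N X) \<and>
     (\<forall>X \<in> carrier_mat n n. \<forall>Y \<in> carrier_mat n n. N (X + Y) \<le> N X + N Y)"

definition unitarily_invariant_norm :: "nat \<Rightarrow> (complex mat \<Rightarrow> real) \<Rightarrow> bool" where
  "unitarily_invariant_norm n N \<longleftrightarrow>
     mat_norm_on n N \<and>
     (\<forall>X \<in> carrier_mat n n. \<forall>U \<in> unitary_mats n. \<forall>V \<in> unitary_mats n. N (U * X * V) = N X)"

(* Indices are 0-based, so the 1-based partner n+1-i of i becomes n-1-i, and the
   1-based range 1 <= i <= floor (n/2) becomes i < n div 2. *)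
definition rotation_mat :: "nat \<Rightarrow> real \<Rightarrow> real mat" where
  "rotation_mat n \<theta> = mat n n (\<lambda>(i, j).
     if i = j then (if odd n \<and> i = n div 2 then 1 else cos \<theta>)
     else if i < n div 2 \<and> j = n - 1 - i then - sin \<theta>
     else if j < n div 2 \<and> i = n - 1 - j then sin \<theta>
     else 0)"

end

theory Submission
  imports Defs "Jordan_Normal_Form.Spectral_Radius" "HOL-Combinatorics.Transposition"
begin

text \<open>
  Diagonalise the skew-Hermitian commutator as \<open>[A, U B U\<^sup>*] = -i W diag(k) W\<^sup>*\<close>. By unitary
  invariance and convexity, the norm of a diagonal matrix is monotone under weak majorization, so
  it suffices to bound every sum \<open>\<Sum> h\<^sub>i k\<^sub>i\<close> with \<open>|h\<^sub>i| \<le> 1\<close> and \<open>\<Sum> |h\<^sub>i| \<le> m\<close> by the sum of the \<open>m\<close>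
  largest singular values of the claimed maximiser. These are, each twice and in decreasing order,
  \<open>(\<lambda>\<^sub>j - \<lambda>\<^sub>n\<^sub>+\<^sub>1\<^sub>-\<^sub>j)(d\<^sub>j - d\<^sub>n\<^sub>+\<^sub>1\<^sub>-\<^sub>j)/2\<close>.

  The quantity to bound is \<open>tr(H [A', B'])\<close> with \<open>H = diag(h)\<close>, up to a factor of modulus 1.
  It is bilinear in the two spectra, and both sides decompose along the layers
  \<open>\<lambda> = \<lambda>\<^sub>n + \<Sum>\<^sub>k (\<lambda>\<^sub>k - \<lambda>\<^sub>k\<^sub>+\<^sub>1) 1\<^sub>\<le>\<^sub>k\<close>. This leaves the case of two orthogonal projections \<open>E\<close>, \<open>F\<close>
  of ranks \<open>k\<close>, \<open>l\<close>, where \<open>|tr(H [E, F])| \<le> min(m/2, k, n - k, l, n - l)\<close> follows from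
  \<open>|v\<^sup>* [S, T] v| \<le> 2 |v|\<^sup>2\<close> for Hermitian contractions \<open>S\<close>, \<open>T\<close> by cycling the trace.
\<close>

section \<open>Adjoints, unitary matrices and the spectral theorem\<close>

lemma index_mult_mat_sum:
  assumes "A \<in> carrier_mat n m" "B \<in> carrier_mat m k" "i < n" "j < k"
  shows "(A * B) $$ (i, j) = (\<Sum>r<m. A $$ (i, r) * B $$ (r, j))"
  using assms by (simp add: scalar_prod_def atLeast0LessThan)

lemma mat_adjoint_carrier [simp, intro]:
  "A \<in> carrier_mat n m \<Longrightarrow> mat_adjoint A \<in> carrier_mat m n"
  unfolding mat_adjoint_def by (auto simp: mat_of_rows_def)

lemma mat_adjoint_dims [simp]:
  "dim_row (mat_adjoint A) = dim_col A" "dim_col (mat_adjoint A) = dim_row A"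
  using mat_adjoint_carrier[of A "dim_row A" "dim_col A"] unfolding carrier_mat_def by auto

lemma mat_adjoint_index [simp]:
  fixes A :: "complex mat"
  shows "i < dim_col A \<Longrightarrow> j < dim_row A \<Longrightarrow> mat_adjoint A $$ (i, j) = cnj (A $$ (j, i))"
  unfolding mat_adjoint_def by (simp add: mat_of_rows_index conjugate_complex_def)

lemma mat_adjoint_adjoint [simp]: "mat_adjoint (mat_adjoint A) = (A :: complex mat)"
  by (rule eq_matI) auto

lemma mat_adjoint_mult:
  fixes A B :: "complex mat"
  assumes "A \<in> carrier_mat n m" "B \<in> carrier_mat m k"
  shows "mat_adjoint (A * B) = mat_adjoint B * mat_adjoint A"
  using assms by (intro eq_matI) (auto simp: scalar_prod_def mult.commute)

lemma mat_adjoint_one [simp]: "mat_adjoint (1\<^sub>m n) = (1\<^sub>m n :: complex mat)"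
  by (rule eq_matI) auto

lemma mat_adjoint_minus:
  fixes A B :: "complex mat"
  assumes "A \<in> carrier_mat n m" "B \<in> carrier_mat n m"
  shows "mat_adjoint (A - B) = mat_adjoint A - mat_adjoint B"
  using assms by (intro eq_matI) auto

lemma mat_adjoint_smult:
  "mat_adjoint (c \<cdot>\<^sub>m A) = cnj c \<cdot>\<^sub>m mat_adjoint (A :: complex mat)"
  by (rule eq_matI) auto

lemma unitary_mats_carrier: "U \<in> unitary_mats n \<Longrightarrow> U \<in> carrier_mat n n"
  by (simp add: unitary_mats_def)

text \<open>A one-sided inverse of a square matrix is two-sided, so unitarity proofs check a single
  product.\<close>

lemma unitary_mats_iff:
  "U \<in> unitary_mats n \<longleftrightarrow> U \<in> carrier_mat n n \<and> mat_adjoint U * U = 1\<^sub>m n"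
  unfolding unitary_mats_def
  using mat_mult_left_right_inverse[of "mat_adjoint U" n U] by auto

lemma unitary_mats_adjoint: "U \<in> unitary_mats n \<Longrightarrow> mat_adjoint U \<in> unitary_mats n"
  by (auto simp: unitary_mats_def)

lemma unitary_mats_one: "1\<^sub>m n \<in> unitary_mats n"
  by (auto simp: unitary_mats_iff)

lemma unitary_mats_cancel:
  assumes "U \<in> unitary_mats n" "X \<in> carrier_mat n m"
  shows "mat_adjoint U * (U * X) = X" "U * (mat_adjoint U * X) = X"
proof -
  have U: "U \<in> carrier_mat n n" "mat_adjoint U \<in> carrier_mat n n"
    using assms by (auto simp: unitary_mats_def)
  show "mat_adjoint U * (U * X) = X"
    using assms U by (simp add: assoc_mult_mat[symmetric, OF U(2,1)] unitary_mats_def)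
  show "U * (mat_adjoint U * X) = X"
    using assms U by (simp add: assoc_mult_mat[symmetric, OF U(1,2)] unitary_mats_def)
qed

lemma unitary_mats_mult:
  assumes "U \<in> unitary_mats n" "V \<in> unitary_mats n"
  shows "U * V \<in> unitary_mats n"
proof -
  have U: "U \<in> carrier_mat n n" and V: "V \<in> carrier_mat n n"
    using assms by (auto simp: unitary_mats_def)
  have "mat_adjoint (U * V) * (U * V) = mat_adjoint V * (mat_adjoint U * (U * V))"
    using U V by (simp add: mat_adjoint_mult[OF U V] assoc_mult_mat[of _ n n _ n _ n])
  also have "\<dots> = 1\<^sub>m n"
    using assms V by (simp add: unitary_mats_cancel[OF assms(1) V] unitary_mats_def)
  finally show ?thesis using U V by (simp add: unitary_mats_iff)
qed

section \<open>Unitary diagonalisation of Hermitian matrices\<close>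

lemma mat_adjoint_four_block:
  fixes A :: "complex mat"
  assumes "A \<in> carrier_mat n1 n1" "D \<in> carrier_mat n2 n2"
  shows "mat_adjoint (four_block_mat A (0\<^sub>m n1 n2) (0\<^sub>m n2 n1) D)
    = four_block_mat (mat_adjoint A) (0\<^sub>m n1 n2) (0\<^sub>m n2 n1) (mat_adjoint D)"
  using assms by (intro eq_matI) auto

lemma mult_block_diagonal:
  fixes A :: "complex mat"
  assumes "A \<in> carrier_mat n1 n1" "A' \<in> carrier_mat n1 n1"
    "D \<in> carrier_mat n2 n2" "D' \<in> carrier_mat n2 n2"
  shows "four_block_mat A (0\<^sub>m n1 n2) (0\<^sub>m n2 n1) D * four_block_mat A' (0\<^sub>m n1 n2) (0\<^sub>m n2 n1) D'
    = four_block_mat (A * A') (0\<^sub>m n1 n2) (0\<^sub>m n2 n1) (D * D')"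
  using assms by (subst mult_four_block_mat[of _ n1 n1 _ n2 _ n2 _ _ n1 _ n2]) auto

lemma cnj_mult_self: "cnj z * z = complex_of_real ((cmod z)\<^sup>2)"
  by (simp only: complex_norm_square mult.commute)

text \<open>An eigenvector is completed to a basis and orthogonalised by Gram-Schmidt, which keeps
  the first vector. After normalisation the first column of \<open>W\<close> is an eigenvector, and
  the other columns are orthogonal to its image under \<open>A\<close>.\<close>

lemma exists_unitary_first_column:
  fixes A :: "complex mat"
  assumes A: "A \<in> carrier_mat n n" and n: "n \<noteq> 0"
  obtains W e where "W \<in> unitary_mats n"
    "\<And>i. i < n \<Longrightarrow> (mat_adjoint W * A * W) $$ (i, 0) = (if i = 0 then e else 0)"
proof -
  from spectrum_non_empty[OF A] n obtain e where "eigenvalue A e"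
    by (auto simp: spectrum_def)
  then obtain v where ev: "eigenvector A v e" unfolding eigenvalue_def by auto
  then have v: "v \<in> carrier_vec n" and v0: "v \<noteq> 0\<^sub>v n" and Av: "A *\<^sub>v v = e \<cdot>\<^sub>v v"
    using A unfolding eigenvector_def by auto
  interpret cof_vec_space n "TYPE(complex)" .
  define b where "b = basis_completion v"
  define ws where "ws = gram_schmidt n b"
  define P where "P = mat_of_cols n ws"
  from basis_completion[OF v v0, folded b_def]
  have span_b: "span (set b) = carrier_vec n" and dist_b: "distinct b" 
    and indep: "\<not> lin_dep (set b)" and b: "set b \<subseteq> carrier_vec n" and hdb: "hd b = v" 
    and len_b: "length b = n" by auto
  from hdb len_b n obtain vs where bv: "b = v # vs" by (cases b, auto)
  from gram_schmidt_result[OF b dist_b indep refl, folded ws_def]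
  have ws: "set ws \<subseteq> carrier_vec n" "corthogonal ws" "length ws = n" 
    by (auto simp: len_b)
  from gram_schmidt_hd[OF v, of vs, folded bv] have hdws: "hd ws = v" unfolding ws_def .
  have orth: "corthogonal_mat P" using orthogonal_mat_of_cols ws unfolding P_def .
  have P: "P \<in> carrier_mat n n"
    using ws unfolding P_def using mat_of_cols_carrier(1)[of n ws] by auto
  have P0: "P $$ (i, 0) = v $ i" if "i < n" for i
    using that n ws hdws unfolding P_def by (cases ws) (auto simp: mat_of_cols_index)
  \<comment> \<open>The columns of \<open>P\<close> are orthogonal but not normalised;
    \<open>r j\<close> is the length of column \<open>j\<close>.\<close>
  define r where "r j = sqrt (\<Sum>i<n. (cmod (P $$ (i, j)))\<^sup>2)" for j
  have inner: "(\<Sum>k<n. cnj (P $$ (k, i)) * P $$ (k, j)) = (if i = j then complex_of_real ((r j)\<^sup>2) else 0)"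
    if "i < n" "j < n" for i j
  proof (cases "i = j")
    case True
    then show ?thesis
      unfolding r_def
      by (simp add: cnj_mult_self sum_nonneg del: of_real_power)
  next
    case False
    then have "col P j \<bullet>c col P i = 0"
      using corthogonal_matD[OF orth] that P by auto
    then show ?thesis using False that P
      by (simp add: scalar_prod_def conjugate_complex_def mult.commute atLeast0LessThan)
  qed
  have rpos: "r j \<noteq> 0" if "j < n" for j
  proof
    assume "r j = 0"
    with inner[OF that that] have "(\<Sum>k<n. cnj (P $$ (k, j)) * P $$ (k, j)) = 0" by simp
    moreover have "col P j \<bullet>c col P j \<noteq> 0" using corthogonal_matD[OF orth] that P by auto
    ultimately show False using that P
      by (simp add: scalar_prod_def conjugate_complex_def mult.commute atLeast0LessThan)
  qed
  define W where "W = mat n n (\<lambda>(i, j). P $$ (i, j) / complex_of_real (r j))"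
  have Wc: "W \<in> carrier_mat n n" by (simp add: W_def)
  have Winner: "(\<Sum>k<n. cnj (W $$ (k, i)) * W $$ (k, j)) = (if i = j then 1 else 0)"
    if "i < n" "j < n" for i j
  proof -
    have "(\<Sum>k<n. cnj (W $$ (k, i)) * W $$ (k, j))
       = (\<Sum>k<n. cnj (P $$ (k, i)) * P $$ (k, j)) / (complex_of_real (r i) * complex_of_real (r j))"
      using that by (simp add: W_def sum_divide_distrib)
    then show ?thesis using that rpos[OF that(1)] inner[OF that] by (auto simp: power2_eq_square)
  qed
  have WW: "mat_adjoint W * W = 1\<^sub>m n"
    using Wc Winner by (intro eq_matI) (auto simp: scalar_prod_def atLeast0LessThan)
  have AW: "(A * W) $$ (i, 0) = e * W $$ (i, 0)" if "i < n" for i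
  proof -
    have "(A * W) $$ (i, 0) = (\<Sum>k<n. A $$ (i, k) * (v $ k / complex_of_real (r 0)))"
      using that A Wc n by (simp add: scalar_prod_def atLeast0LessThan W_def P0)
    also have "\<dots> = (A *\<^sub>v v) $ i / complex_of_real (r 0)"
      using that A v by (simp add: scalar_prod_def atLeast0LessThan sum_divide_distrib)
    also have "\<dots> = e * W $$ (i, 0)" using that v n by (simp add: Av W_def P0)
    finally show ?thesis .
  qed
  have "(mat_adjoint W * A * W) $$ (i, 0) = (if i = 0 then e else 0)" if "i < n" for i
  proof -
    have "mat_adjoint W * A * W = mat_adjoint W * (A * W)"
      using A Wc by (simp add: assoc_mult_mat[of _ n n _ n _ n])
    then have "(mat_adjoint W * A * W) $$ (i, 0) = (\<Sum>k<n. cnj (W $$ (k, i)) * (A * W) $$ (k, 0))"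
      using that n Wc A
      by (simp add: index_mult_mat_sum[of _ n n _ n] mult_carrier_mat[of _ n n] del: index_mult_mat(1))
    also have "\<dots> = e * (\<Sum>k<n. cnj (W $$ (k, i)) * W $$ (k, 0))"
      by (simp add: AW sum_distrib_left mult.left_commute)
    finally show ?thesis using Winner[OF that, of 0] n by auto
  qed
  then show ?thesis using that Wc WW by (auto simp: unitary_mats_iff)
qed

text \<open>Deflation: in a basis starting with an eigenvector the first column is a multiple of a
  unit vector, Hermitian symmetry clears the first row too, and the remaining block is Hermitian of
  size \<open>n\<close>.\<close>

lemma hermitian_unitary_diagonalization:
  fixes A :: "complex mat"
  assumes "A \<in> carrier_mat n n" "hermitian_mat A"
  shows "\<exists>W \<in> unitary_mats n. \<exists>k :: nat \<Rightarrow> real.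
    mat_adjoint W * A * W = mat_diag n (\<lambda>i. complex_of_real (k i))"
  using assms
proof (induction n arbitrary: A)
  case 0
  then show ?case
    by (intro bexI[of _ "1\<^sub>m 0"]) (auto simp: unitary_mats_one mat_diag_def intro!: eq_matI)
next
  case (Suc n)
  obtain W e where W: "W \<in> unitary_mats (Suc n)"
    and col0: "\<And>i. i < Suc n \<Longrightarrow> (mat_adjoint W * A * W) $$ (i, 0) = (if i = 0 then e else 0)"
    using exists_unitary_first_column[OF Suc.prems(1)] by blast
  note Wc = unitary_mats_carrier[OF W]
  define M where "M = mat_adjoint W * A * W"
  have Mc: "M \<in> carrier_mat (Suc n) (Suc n)" using Wc Suc.prems(1)
    by (simp add: M_def mult_carrier_mat[of _ "Suc n" "Suc n"])
  have Mh: "mat_adjoint M = M"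
    using Wc Suc.prems unfolding M_def hermitian_mat_def
    by (simp add: mat_adjoint_mult[of _ "Suc n" "Suc n" _ "Suc n"] assoc_mult_mat[of _ "Suc n" "Suc n" _ "Suc n" _ "Suc n"])
  have Mij: "M $$ (j, i) = cnj (M $$ (i, j))" if "i < Suc n" "j < Suc n" for i j
    using that Mc by (subst Mh[symmetric]) simp
  have col: "M $$ (i, 0) = (if i = 0 then e else 0)" if "i < Suc n" for i
    using col0[OF that] by (simp add: M_def)
  have ecnj: "cnj e = e" using Mij[of 0 0] col[of 0] by simp
  then have ereal: "e = complex_of_real (Re e)" by (simp add: complex_eq_iff)
  define M' where "M' = mat n n (\<lambda>(i, j). M $$ (Suc i, Suc j))"
  have M'c: "M' \<in> carrier_mat n n" by (simp add: M'_def)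
  have "hermitian_mat M'" unfolding hermitian_mat_def
    using Mij[symmetric] by (intro eq_matI) (auto simp: M'_def)
  from Suc.IH[OF M'c this] obtain W' k where W': "W' \<in> unitary_mats n"
    and k: "mat_adjoint W' * M' * W' = mat_diag n (\<lambda>i. complex_of_real (k i))" by blast
  note W'c = unitary_mats_carrier[OF W']
  have blockM: "M = four_block_mat (e \<cdot>\<^sub>m 1\<^sub>m 1) (0\<^sub>m 1 n) (0\<^sub>m n 1) M'"
    using Mc col Mij[of _ 0] ecnj by (intro eq_matI) (auto simp: M'_def)
  \<comment> \<open>The diagonaliser of the smaller block, extended by 1 so that the first basis
    vector stays fixed.\<close>
  define X where "X = four_block_mat (1\<^sub>m 1) (0\<^sub>m 1 n) (0\<^sub>m n 1) W'"
  have Xc: "X \<in> carrier_mat (Suc n) (Suc n)" using four_block_carrier_mat[of "1\<^sub>m 1" 1 1 W' n n] W'c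
    by (simp add: X_def)
  have Xad: "mat_adjoint X = four_block_mat (1\<^sub>m 1) (0\<^sub>m 1 n) (0\<^sub>m n 1) (mat_adjoint W')"
    unfolding X_def using W'c by (subst mat_adjoint_four_block) auto
  have "mat_adjoint X * X = four_block_mat (1\<^sub>m 1) (0\<^sub>m 1 n) (0\<^sub>m n 1) (1\<^sub>m n)"
    unfolding Xad unfolding X_def using W' W'c
    by (subst mult_block_diagonal) (auto simp: unitary_mats_def)
  also have "\<dots> = 1\<^sub>m (Suc n)" by (intro eq_matI) auto
  finally have X: "X \<in> unitary_mats (Suc n)" using Xc by (simp add: unitary_mats_iff)
  have "mat_adjoint (W * X) * A * (W * X) = mat_adjoint X * M * X"
    unfolding M_def using Wc Xc Suc.prems(1)
    by (simp add: mult_carrier_mat[of _ "Suc n" "Suc n"] mat_adjoint_mult[of _ "Suc n" "Suc n" _ "Suc n"] assoc_mult_mat[of _ "Suc n" "Suc n" _ "Suc n" _ "Suc n"])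
  also have "\<dots> = four_block_mat (e \<cdot>\<^sub>m 1\<^sub>m 1) (0\<^sub>m 1 n) (0\<^sub>m n 1) (mat_adjoint W' * M' * W')"
    unfolding Xad blockM unfolding X_def using W'c M'c
    by (subst mult_block_diagonal, auto)+
  also have "\<dots> = mat_diag (Suc n) (\<lambda>i. complex_of_real (case i of 0 \<Rightarrow> Re e | Suc j \<Rightarrow> k j))"
    unfolding k using ereal
    by (intro eq_matI) (auto simp: mat_diag_def split: nat.splits)
  finally show ?case using unitary_mats_mult[OF W X] by blast
qed

section \<open>Trace and Frobenius norm\<close>

definition mat_trace :: "complex mat \<Rightarrow> complex" where
  "mat_trace A = (\<Sum>i<dim_row A. A $$ (i, i))"

definition frob_sq :: "complex mat \<Rightarrow> real" where
  "frob_sq A = (\<Sum>j<dim_col A. \<Sum>i<dim_row A. (cmod (A $$ (i, j)))\<^sup>2)"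

lemma mat_trace_comm:
  assumes "A \<in> carrier_mat n m" "B \<in> carrier_mat m n"
  shows "mat_trace (A * B) = mat_trace (B * A)"
proof -
  have "mat_trace (A * B) = (\<Sum>i<n. \<Sum>j<m. A $$ (i, j) * B $$ (j, i))"
    using assms by (simp add: mat_trace_def scalar_prod_def atLeast0LessThan)
  also have "\<dots> = (\<Sum>j<m. \<Sum>i<n. B $$ (j, i) * A $$ (i, j))"
    by (subst sum.swap) (simp add: mult.commute)
  also have "\<dots> = mat_trace (B * A)"
    using assms by (simp add: mat_trace_def scalar_prod_def atLeast0LessThan)
  finally show ?thesis .
qed

lemma mat_trace_minus:
  assumes "A \<in> carrier_mat n n" "B \<in> carrier_mat n n"
  shows "mat_trace (A - B) = mat_trace A - mat_trace B"
  using assms by (simp add: mat_trace_def sum_subtractf)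

lemma mat_trace_adjoint_mult:
  assumes "Y \<in> carrier_mat n m" "Z \<in> carrier_mat n m"
  shows "mat_trace (mat_adjoint Y * Z) = (\<Sum>j<m. \<Sum>i<n. cnj (Y $$ (i, j)) * Z $$ (i, j))"
  using assms by (simp add: mat_trace_def scalar_prod_def atLeast0LessThan)

lemma frob_sq_eq_trace:
  assumes "X \<in> carrier_mat n m"
  shows "complex_of_real (frob_sq X) = mat_trace (mat_adjoint X * X)"
  using assms by (simp add: mat_trace_adjoint_mult[OF assms assms] frob_sq_def cnj_mult_self del: of_real_power)

text \<open>AM-GM entry by entry takes the place of Cauchy-Schwarz; nothing is lost below, where
  both Frobenius norms have the same bound.\<close>

lemma cmod_mat_trace_adjoint_mult_le:
  assumes "Y \<in> carrier_mat n m" "Z \<in> carrier_mat n m"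
  shows "cmod (mat_trace (mat_adjoint Y * Z)) \<le> (frob_sq Y + frob_sq Z) / 2"
proof -
  have "cmod (mat_trace (mat_adjoint Y * Z))
      \<le> (\<Sum>j<m. \<Sum>i<n. cmod (cnj (Y $$ (i, j)) * Z $$ (i, j)))"
    unfolding mat_trace_adjoint_mult[OF assms] by (intro sum_norm_le norm_sum)
  also have "\<dots> \<le> (\<Sum>j<m. \<Sum>i<n. ((cmod (Y $$ (i, j)))\<^sup>2 + (cmod (Z $$ (i, j)))\<^sup>2) / 2)"
  proof (intro sum_mono)
    fix i j
    have "0 \<le> (cmod (Y $$ (i, j)) - cmod (Z $$ (i, j)))\<^sup>2" by simp
    then show "cmod (cnj (Y $$ (i, j)) * Z $$ (i, j))
      \<le> ((cmod (Y $$ (i, j)))\<^sup>2 + (cmod (Z $$ (i, j)))\<^sup>2) / 2"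
      by (simp add: norm_mult power2_diff)
  qed
  also have "\<dots> = (frob_sq Y + frob_sq Z) / 2"
    using assms by (simp add: frob_sq_def sum.distrib sum_divide_distrib add_divide_distrib)
  finally show ?thesis .
qed

text \<open>For Hermitian \<open>S\<close>, \<open>T\<close> the matrix inside the trace is
  \<open>(S X)^* (T X) - (T X)^* (S X)\<close>, and each of the two traces is at most
  \<open>frob_sq X\<close>. The bound is applied to a coordinate projection and to a spectral
  projection as \<open>X\<close>.\<close>

lemma cmod_trace_commutator_le:
  assumes S: "S \<in> carrier_mat n n" "mat_adjoint S = S"
    and T: "T \<in> carrier_mat n n" "mat_adjoint T = T"
    and X: "X \<in> carrier_mat n n"
    and SX: "frob_sq (S * X) \<le> frob_sq X" and TX: "frob_sq (T * X) \<le> frob_sq X"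
  shows "cmod (mat_trace (mat_adjoint X * mat_commutator S T * X)) \<le> 2 * frob_sq X"
proof -
  have SXc: "S * X \<in> carrier_mat n n" and TXc: "T * X \<in> carrier_mat n n"
    using S T X by auto
  have "mat_adjoint X * mat_commutator S T * X
      = mat_adjoint (S * X) * (T * X) - mat_adjoint (T * X) * (S * X)"
  proof -
    have "mat_adjoint (S * X) * (T * X) = mat_adjoint X * (S * T) * X"
      using S T X by (simp add: mat_adjoint_mult[of _ n n _ n] assoc_mult_mat[of _ n n _ n _ n] mult_carrier_mat[of _ n n])
    moreover have "mat_adjoint (T * X) * (S * X) = mat_adjoint X * (T * S) * X"
      using S T X by (simp add: mat_adjoint_mult[of _ n n _ n] assoc_mult_mat[of _ n n _ n _ n] mult_carrier_mat[of _ n n])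
    ultimately show ?thesis
      unfolding mat_commutator_def using S T X
      by (simp add: mult_minus_distrib_mat[of _ n n _ n] minus_mult_distrib_mat[of _ n n _ _ n] mult_carrier_mat[of _ n n])
  qed
  then have "mat_trace (mat_adjoint X * mat_commutator S T * X)
      = mat_trace (mat_adjoint (S * X) * (T * X)) - mat_trace (mat_adjoint (T * X) * (S * X))"
    using SXc TXc by (simp add: mat_trace_minus[of _ n] mult_carrier_mat[of _ n n])
  also have "cmod \<dots> \<le> cmod (mat_trace (mat_adjoint (S * X) * (T * X)))
      + cmod (mat_trace (mat_adjoint (T * X) * (S * X)))"
    by (rule norm_triangle_ineq4)
  also have "\<dots> \<le> 2 * frob_sq X"
    using cmod_mat_trace_adjoint_mult_le[OF SXc TXc] cmod_mat_trace_adjoint_mult_le[OF TXc SXc] SX TX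
    by argo
  finally show ?thesis .
qed

lemma frob_sq_unitary_mult:
  assumes U: "U \<in> unitary_mats n" and X: "X \<in> carrier_mat n m"
  shows "frob_sq (U * X) = frob_sq X"
proof -
  note Uc = unitary_mats_carrier[OF U]
  have UX: "U * X \<in> carrier_mat n m" using Uc X by auto
  have "mat_adjoint (U * X) * (U * X) = mat_adjoint X * (mat_adjoint U * (U * X))"
    using Uc X UX by (simp add: mat_adjoint_mult[OF Uc X] assoc_mult_mat[of _ m n _ n _ m])
  then have "complex_of_real (frob_sq (U * X)) = complex_of_real (frob_sq X)"
    unfolding frob_sq_eq_trace[OF UX] frob_sq_eq_trace[OF X]
    by (simp add: unitary_mats_cancel[OF U X])
  then show ?thesis by (simp only: of_real_eq_iff)
qed

section \<open>Real diagonal matrices and matrices with a given eigenbasis\<close>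

definition rdiag :: "nat \<Rightarrow> (nat \<Rightarrow> real) \<Rightarrow> complex mat" where
  "rdiag n f = mat_diag n (\<lambda>i. complex_of_real (f i))"

lemma rdiag_carrier [simp]: "rdiag n f \<in> carrier_mat n n"
  by (simp add: rdiag_def)

lemma rdiag_index [simp]:
  "i < n \<Longrightarrow> j < n \<Longrightarrow> rdiag n f $$ (i, j) = (if i = j then complex_of_real (f i) else 0)"
  by (simp add: rdiag_def mat_diag_def)

lemma rdiag_dims [simp]: "dim_row (rdiag n f) = n" "dim_col (rdiag n f) = n"
  by (simp_all add: rdiag_def mat_diag_def)

lemma rdiag_adjoint [simp]: "mat_adjoint (rdiag n f) = rdiag n f"
  by (rule eq_matI) auto

lemma rdiag_mult: "rdiag n f * rdiag n g = rdiag n (\<lambda>i. f i * g i)"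
  by (simp add: rdiag_def)

text \<open>Eigenbasis and eigenvalues are kept apart, so that the matrix is linear in
  \<open>f\<close>, as the layer decomposition requires.\<close>

definition spectral_mat :: "nat \<Rightarrow> complex mat \<Rightarrow> (nat \<Rightarrow> real) \<Rightarrow> complex mat" where
  "spectral_mat n U f = U * rdiag n f * mat_adjoint U"

lemma spectral_mat_carrier: "U \<in> carrier_mat n n \<Longrightarrow> spectral_mat n U f \<in> carrier_mat n n"
  by (auto simp: spectral_mat_def intro!: mult_carrier_mat[of _ n n])

lemma spectral_mat_adjoint:
  "U \<in> carrier_mat n n \<Longrightarrow> mat_adjoint (spectral_mat n U f) = spectral_mat n U f"
  by (simp add: spectral_mat_def mat_adjoint_mult[of _ n n _ n] assoc_mult_mat[of _ n n _ n _ n] mult_carrier_mat[of _ n n])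

lemma spectral_mat_mult:
  assumes U: "U \<in> unitary_mats n"
  shows "spectral_mat n U f * spectral_mat n U g = spectral_mat n U (\<lambda>i. f i * g i)"
proof -
  note Uc = unitary_mats_carrier[OF U]
  have "spectral_mat n U f * spectral_mat n U g
      = U * (rdiag n f * (mat_adjoint U * (U * (rdiag n g * mat_adjoint U))))"
    using Uc by (simp add: spectral_mat_def assoc_mult_mat[of _ n n _ n _ n] mult_carrier_mat[of _ n n])
  also have "\<dots> = U * (rdiag n f * (rdiag n g * mat_adjoint U))"
    using Uc by (simp add: unitary_mats_cancel(1)[OF U, of _ n] mult_carrier_mat[of _ n n])
  also have "\<dots> = U * (rdiag n f * rdiag n g) * mat_adjoint U"
    using Uc by (simp add: assoc_mult_mat[of _ n n _ n _ n] mult_carrier_mat[of _ n n])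
  finally show ?thesis by (simp add: rdiag_mult spectral_mat_def)
qed

lemma spectral_mat_one:
  assumes "U \<in> unitary_mats n" "\<And>i. i < n \<Longrightarrow> f i = 1"
  shows "spectral_mat n U f = 1\<^sub>m n"
proof -
  have "rdiag n f = 1\<^sub>m n" using assms(2) by (intro eq_matI) auto
  with assms(1) show ?thesis
    by (simp add: spectral_mat_def unitary_mats_def right_mult_one_mat[of _ n n])
qed

lemma spectral_mat_trace:
  assumes U: "U \<in> unitary_mats n"
  shows "mat_trace (spectral_mat n U f) = complex_of_real (\<Sum>i<n. f i)"
proof -
  note Uc = unitary_mats_carrier[OF U]
  have "mat_trace (spectral_mat n U f) = mat_trace (mat_adjoint U * (U * rdiag n f))"
    unfolding spectral_mat_def using Uc by (intro mat_trace_comm) (auto intro!: mult_carrier_mat[of _ n n])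
  also have "\<dots> = mat_trace (rdiag n f)" by (simp add: unitary_mats_cancel(1)[OF U, of _ n])
  finally show ?thesis by (simp add: mat_trace_def)
qed

lemma spectral_mat_index:
  assumes "U \<in> carrier_mat n n" "i < n" "j < n"
  shows "spectral_mat n U f $$ (i, j) = (\<Sum>r<n. complex_of_real (f r) * (U $$ (i, r) * cnj (U $$ (j, r))))"
proof -
  have "(U * rdiag n f) $$ (i, r) = U $$ (i, r) * complex_of_real (f r)" if "r < n" for r
    using assms that by (simp add: rdiag_def mat_diag_mult_right[OF assms(1)])
  then show ?thesis
    using assms by (simp add: spectral_mat_def index_mult_mat_sum[of _ n n _ n] mult_carrier_mat[of _ n n]
      mult_ac del: index_mult_mat(1))
qed

text \<open>Signs as eigenvalues give a Hermitian involution, so its inverse and its adjoint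
  coincide.\<close>

lemma spectral_mat_reflection:
  assumes U: "U \<in> unitary_mats n" and f: "\<And>i. i < n \<Longrightarrow> f i * f i = 1"
  shows "spectral_mat n U f \<in> unitary_mats n"
  using spectral_mat_mult[OF U, of f f] spectral_mat_one[OF U, of "\<lambda>i. f i * f i"] f
    spectral_mat_carrier[OF unitary_mats_carrier[OF U]] spectral_mat_adjoint[OF unitary_mats_carrier[OF U]]
  by (simp add: unitary_mats_iff)

section \<open>The trace form of a commutator\<close>

text \<open>This is \<open>tr(H [A, B])\<close> for \<open>H = diag(h)\<close>, written with the
  diagonal entries of the commutator. It is bilinear in the spectra \<open>f\<close> and
  \<open>g\<close>.\<close>

definition comm_form :: "nat \<Rightarrow> (nat \<Rightarrow> real) \<Rightarrow> complex mat \<Rightarrow> complex mat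
    \<Rightarrow> (nat \<Rightarrow> real) \<Rightarrow> (nat \<Rightarrow> real) \<Rightarrow> complex" where
  "comm_form n h U V f g =
    (\<Sum>i<n. complex_of_real (h i) * mat_commutator (spectral_mat n U f) (spectral_mat n V g) $$ (i, i))"

lemma mat_commutator_carrier:
  "A \<in> carrier_mat n n \<Longrightarrow> B \<in> carrier_mat n n \<Longrightarrow> mat_commutator A B \<in> carrier_mat n n"
  by (simp add: mat_commutator_def mult_carrier_mat[of _ n n] minus_carrier_mat[of _ n n])

lemma mat_commutator_index:
  assumes "A \<in> carrier_mat n n" "B \<in> carrier_mat n n" "i < n" "j < n"
  shows "mat_commutator A B $$ (i, j) = (\<Sum>r<n. A $$ (i, r) * B $$ (r, j) - B $$ (i, r) * A $$ (r, j))"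
  using assms by (simp add: mat_commutator_def index_mult_mat_sum[of _ n n _ n] sum_subtractf
    del: index_mult_mat(1))

context
  fixes n :: nat and U V :: "complex mat" and h :: "nat \<Rightarrow> real"
  assumes U: "U \<in> unitary_mats n" and V: "V \<in> unitary_mats n"
begin

lemma comm_form_index:
  "comm_form n h U V f g = (\<Sum>i<n. \<Sum>j<n. complex_of_real (h i) *
    (spectral_mat n U f $$ (i, j) * spectral_mat n V g $$ (j, i)
     - spectral_mat n V g $$ (i, j) * spectral_mat n U f $$ (j, i)))"
  unfolding comm_form_def
  by (simp add: mat_commutator_index[of _ n] spectral_mat_carrier unitary_mats_carrier[OF U]
      unitary_mats_carrier[OF V] sum_distrib_left)

text \<open>Antisymmetry of the commutator; it carries facts about the left spectrum over to the
  right one.\<close>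

lemma comm_form_swap: "comm_form n h V U g f = - comm_form n h U V f g"
  unfolding comm_form_def sum_negf[symmetric]
  by (intro sum.cong refl)
     (simp add: mat_commutator_index[of _ n] spectral_mat_carrier unitary_mats_carrier[OF U]
      unitary_mats_carrier[OF V] sum_distrib_left sum_subtractf algebra_simps)

lemma comm_form_sum_left:
  "comm_form n h U V (\<lambda>r. \<Sum>k\<in>K. c k * f k r) g = (\<Sum>k\<in>K. complex_of_real (c k) * comm_form n h U V (f k) g)"
proof -
  have ix: "spectral_mat n U (\<lambda>r. \<Sum>k\<in>K. c k * f k r) $$ (i, j)
      = (\<Sum>k\<in>K. complex_of_real (c k) * spectral_mat n U (f k) $$ (i, j))" if "i < n" "j < n" for i j
    unfolding spectral_mat_index[OF unitary_mats_carrier[OF U] that]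
    by (simp add: sum_distrib_left sum_distrib_right mult.assoc) (rule sum.swap)
  have "comm_form n h U V (\<lambda>r. \<Sum>k\<in>K. c k * f k r) g = (\<Sum>i<n. \<Sum>j<n. \<Sum>k\<in>K. complex_of_real (c k) * (complex_of_real (h i) *
    (spectral_mat n U (f k) $$ (i, j) * spectral_mat n V g $$ (j, i)
     - spectral_mat n V g $$ (i, j) * spectral_mat n U (f k) $$ (j, i))))"
    unfolding comm_form_index
    by (intro sum.cong refl) (simp add: ix sum_distrib_left sum_distrib_right sum_subtractf algebra_simps)
  also have "\<dots> = (\<Sum>k\<in>K. \<Sum>i<n. \<Sum>j<n. complex_of_real (c k) * (complex_of_real (h i) *
    (spectral_mat n U (f k) $$ (i, j) * spectral_mat n V g $$ (j, i)
     - spectral_mat n V g $$ (i, j) * spectral_mat n U (f k) $$ (j, i))))"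
    by (simp only: sum.swap[of _ _ K])
  finally show ?thesis unfolding comm_form_index by (simp add: sum_distrib_left)
qed

lemma comm_form_cong_left:
  assumes "\<And>i. i < n \<Longrightarrow> f i = f' i"
  shows "comm_form n h U V f g = comm_form n h U V f' g"
proof -
  have "rdiag n f = rdiag n f'" using assms by (intro eq_matI) auto
  then show ?thesis by (simp add: comm_form_def spectral_mat_def)
qed

lemma comm_form_one_left: "comm_form n h U V (\<lambda>_. 1) g = 0"
proof -
  have "mat_commutator (spectral_mat n U (\<lambda>_. 1)) (spectral_mat n V g) = 0\<^sub>m n n"
    using spectral_mat_carrier[OF unitary_mats_carrier[OF V], of g]
    by (simp add: mat_commutator_def spectral_mat_one[OF U])
  then show ?thesis by (simp add: comm_form_def)
qed

text \<open>Shifting the spectrum adds a multiple of the identity, which commutes with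
  everything.\<close>

lemma comm_form_affine_left:
  "comm_form n h U V (\<lambda>r. a + b * f r) g = complex_of_real b * comm_form n h U V f g"
proof -
  have "comm_form n h U V (\<lambda>r. a + b * f r) g
      = comm_form n h U V (\<lambda>r. \<Sum>k\<in>{0, 1::nat}. (if k = 0 then a else b) * (if k = 0 then 1 else f r)) g"
    by simp
  also have "\<dots> = complex_of_real b * comm_form n h U V f g"
    unfolding comm_form_sum_left by (simp add: comm_form_one_left)
  finally show ?thesis .
qed

end

lemma comm_form_affine_right:
  assumes "U \<in> unitary_mats n" "V \<in> unitary_mats n"
  shows "comm_form n h U V f (\<lambda>r. a + b * g r) = complex_of_real b * comm_form n h U V f g"
  using comm_form_affine_left[OF assms(2,1), of h a b g f]
    comm_form_swap[OF assms, of h "\<lambda>r. a + b * g r" f] comm_form_swap[OF assms, of h g f] by simp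

lemma comm_form_sum_right:
  assumes "U \<in> unitary_mats n" "V \<in> unitary_mats n"
  shows "comm_form n h U V f (\<lambda>r. \<Sum>k\<in>K. c k * g k r) = (\<Sum>k\<in>K. complex_of_real (c k) * comm_form n h U V f (g k))"
proof -
  have "comm_form n h U V f g' = - comm_form n h V U g' f" for g'
    using comm_form_swap[OF assms, of h g' f] by simp
  then show ?thesis by (simp add: comm_form_sum_left[OF assms(2,1)] sum_negf)
qed

text \<open>A projection \<open>E\<close> enters a commutator through the reflection \<open>2E - 1\<close>, which is a contraction;
  this gains the factor \<open>1/2\<close> per projection.\<close>

lemma cmod_comm_form_reflections_le:
  assumes U: "U \<in> unitary_mats n" and V: "V \<in> unitary_mats n"
    and f: "\<And>i. i < n \<Longrightarrow> f i * f i = 1" and g: "\<And>i. i < n \<Longrightarrow> g i * g i = 1"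
  shows "cmod (comm_form n h U V f g) \<le> 2 * (\<Sum>i<n. \<bar>h i\<bar>)"
proof -
  define S where "S = spectral_mat n U f"
  define T where "T = spectral_mat n V g"
  have S: "S \<in> carrier_mat n n" "mat_adjoint S = S" "S \<in> unitary_mats n"
    unfolding S_def using unitary_mats_carrier[OF U]
    by (auto intro: spectral_mat_carrier spectral_mat_adjoint spectral_mat_reflection[OF U] f)
  have T: "T \<in> carrier_mat n n" "mat_adjoint T = T" "T \<in> unitary_mats n"
    unfolding T_def using unitary_mats_carrier[OF V]
    by (auto intro: spectral_mat_carrier spectral_mat_adjoint spectral_mat_reflection[OF V] g)
  have C: "mat_commutator S T \<in> carrier_mat n n" by (intro mat_commutator_carrier S T)
  have le2: "cmod (mat_commutator S T $$ (i, i)) \<le> 2" if i: "i < n" for i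
  proof -
    \<comment> \<open>The projection onto coordinate \<open>i\<close> has Frobenius norm 1, and
      sandwiching with it isolates one diagonal entry.\<close>
    define X where "X = rdiag n (\<lambda>j. of_bool (j = i))"
    have X: "X \<in> carrier_mat n n" by (simp add: X_def)
    have "frob_sq X = (\<Sum>j<n. \<Sum>k<n. if k = j then of_bool (j = i) else 0)"
      unfolding frob_sq_def by (intro sum.cong) (auto simp: X_def)
    also have "\<dots> = (\<Sum>j<n. of_bool (j = i))" by simp
    also have "\<dots> = 1" using i by simp
    finally have fX: "frob_sq X = 1" .
    have "mat_trace (mat_adjoint X * mat_commutator S T * X)
      = (\<Sum>j<n. of_bool (j = i) * mat_commutator S T $$ (j, j))"
      using C unfolding X_def rdiag_adjoint
      unfolding mat_trace_def
      by (intro sum.cong) (auto simp: rdiag_def mat_diag_mult_left[OF C] mat_diag_mult_right[of _ n n])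
    also have "\<dots> = mat_commutator S T $$ (i, i)" using i by simp
    finally show ?thesis
      using cmod_trace_commutator_le[OF S(1,2) T(1,2) X] fX
        frob_sq_unitary_mult[OF S(3) X] frob_sq_unitary_mult[OF T(3) X] by simp
  qed
  have "cmod (comm_form n h U V f g) \<le> (\<Sum>i<n. cmod (complex_of_real (h i) * mat_commutator S T $$ (i, i)))"
    unfolding comm_form_def S_def T_def by (rule norm_sum)
  also have "\<dots> \<le> (\<Sum>i<n. \<bar>h i\<bar> * 2)"
    by (intro sum_mono) (auto simp: norm_mult intro!: mult_left_mono le2)
  finally show ?thesis by (simp add: sum_distrib_left mult.commute)
qed

text \<open>As \<open>E\<close> is idempotent, cycling the trace turns \<open>tr(H [E, T])\<close>
  into \<open>tr(E [T, H] E)\<close>. The commutator bound applies with \<open>X = E\<close>: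
  \<open>T\<close> is unitary, \<open>H\<close> is a contraction, and \<open>frob_sq E\<close> is
  the rank of \<open>E\<close>.\<close>

lemma cmod_comm_form_projection_reflection_le:
  assumes U: "U \<in> unitary_mats n" and V: "V \<in> unitary_mats n"
    and f: "\<And>i. i < n \<Longrightarrow> f i * f i = f i" and g: "\<And>i. i < n \<Longrightarrow> g i * g i = 1"
    and h: "\<And>i. i < n \<Longrightarrow> \<bar>h i\<bar> \<le> 1"
  shows "cmod (comm_form n h U V f g) \<le> 2 * (\<Sum>i<n. f i)"
proof -
  define E where "E = spectral_mat n U f"
  define T where "T = spectral_mat n V g"
  define H where "H = rdiag n h"
  note Uc = unitary_mats_carrier[OF U]
  have E: "E \<in> carrier_mat n n" "mat_adjoint E = E"
    unfolding E_def using Uc by (auto intro: spectral_mat_carrier spectral_mat_adjoint)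
  have "rdiag n (\<lambda>i. f i * f i) = rdiag n f" using f by (intro eq_matI) auto
  then have EE: "E * E = E"
    unfolding E_def spectral_mat_mult[OF U] by (simp add: spectral_mat_def)
  have T: "T \<in> carrier_mat n n" "mat_adjoint T = T" "T \<in> unitary_mats n"
    unfolding T_def using unitary_mats_carrier[OF V]
    by (auto intro: spectral_mat_carrier spectral_mat_adjoint spectral_mat_reflection[OF V] g)
  have H: "H \<in> carrier_mat n n" "mat_adjoint H = H" by (simp_all add: H_def)
  have fE: "frob_sq E = (\<Sum>i<n. f i)"
    using frob_sq_eq_trace[OF E(1)] spectral_mat_trace[OF U, of f]
    unfolding E(2) EE by (simp only: E_def[symmetric] of_real_eq_iff)
  have HE: "frob_sq (H * E) \<le> frob_sq E"
  proof -
    have "(cmod ((H * E) $$ (i, j)))\<^sup>2 \<le> (cmod (E $$ (i, j)))\<^sup>2" if "i < n" "j < n" for i j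
    proof -
      have "(H * E) $$ (i, j) = complex_of_real (h i) * E $$ (i, j)"
        unfolding H_def rdiag_def mat_diag_mult_left[OF E(1)] using that by simp
      then show ?thesis using h[OF that(1)]
        by (simp add: norm_mult power_mult_distrib mult_left_le_one_le power_le_one abs_square_le_1)
    qed
    then show ?thesis unfolding frob_sq_def using E H by (auto intro!: sum_mono)
  qed
  have assoc: "\<And>X Y Z. X \<in> carrier_mat n n \<Longrightarrow> Y \<in> carrier_mat n n \<Longrightarrow> Z \<in> carrier_mat n n
      \<Longrightarrow> (X * Y) * Z = X * (Y * (Z :: complex mat))"
    by (rule assoc_mult_mat)
  have mc: "\<And>X Y. X \<in> carrier_mat n n \<Longrightarrow> Y \<in> carrier_mat n n \<Longrightarrow> X * Y \<in> carrier_mat n n"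
    by (rule mult_carrier_mat)
  have EEX: "E * (E * X) = E * X" if "X \<in> carrier_mat n n" for X
    using assoc[OF E(1) E(1) that] EE by simp
  have t1: "mat_trace (E * (T * (H * E))) = mat_trace (H * (E * T))"
  proof -
    have "mat_trace (E * (T * (H * E))) = mat_trace ((E * T) * (H * E))"
      using E T H by (simp add: assoc mc)
    also have "\<dots> = mat_trace ((H * E) * (E * T))"
      using E T H by (intro mat_trace_comm) (auto intro!: mc)
    finally show ?thesis using E T H by (simp add: assoc mc EEX)
  qed
  have t2: "mat_trace (E * (H * (T * E))) = mat_trace (H * (T * E))"
  proof -
    have "mat_trace (E * (H * (T * E))) = mat_trace ((H * (T * E)) * E)"
      using E T H by (intro mat_trace_comm) (auto intro!: mc)
    then show ?thesis using E T H by (simp add: assoc mc EE)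
  qed
  have "comm_form n h U V f g = mat_trace (H * mat_commutator E T)"
    using mat_commutator_carrier[OF E(1) T(1)]
    unfolding comm_form_def E_def[symmetric] T_def[symmetric] H_def
    by (simp add: rdiag_def mat_diag_mult_left[of _ n n] mat_trace_def)
  also have "\<dots> = mat_trace (H * (E * T)) - mat_trace (H * (T * E))"
    using E T H by (simp add: mat_commutator_def mult_minus_distrib_mat[of _ n n _ n] mat_trace_minus[of _ n] mc)
  also have "\<dots> = mat_trace (mat_adjoint E * mat_commutator T H * E)"
    using E T H t1 t2 by (simp add: mat_commutator_def mult_minus_distrib_mat[of _ n n _ n]
      minus_mult_distrib_mat[of _ n n _ _ n] mat_trace_minus[of _ n] mc minus_carrier_mat[of _ n n] assoc)
  finally show ?thesis
    using cmod_trace_commutator_le[OF T(1,2) H(1,2) E(1)] HE frob_sq_unitary_mult[OF T(3) E(1)] fE by simp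
qed

section \<open>Layer decomposition of the spectra\<close>

text \<open>As a spectrum, for \<open>k <= n\<close>, it yields the projection onto the first
  \<open>k\<close> vectors of the eigenbasis.\<close>

definition lower_ind :: "nat \<Rightarrow> nat \<Rightarrow> real" where
  "lower_ind k i = of_bool (i < k)"

text \<open>The smaller of the ranks of a rank \<open>k\<close> projection and of its
  complement.\<close>

definition corank :: "nat \<Rightarrow> nat \<Rightarrow> nat" where
  "corank n k = min k (n - k)"

text \<open>Replacing the second projection \<open>F\<close> by \<open>2F - 1\<close> doubles the
  form, which gives the bound \<open>k\<close>. Complementing the first projection only changes the
  sign, which gives \<open>n - k\<close>.\<close>

lemma cmod_comm_form_lower_ind_le:
  assumes U: "U \<in> unitary_mats n" and V: "V \<in> unitary_mats n"
    and h: "\<And>i. i < n \<Longrightarrow> \<bar>h i\<bar> \<le> 1" and k: "k \<le> n"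
  shows "cmod (comm_form n h U V (lower_ind k) (lower_ind l)) \<le> real (corank n k)"
proof -
  define g where "g i = - 1 + 2 * lower_ind l i" for i
  have g1: "g i * g i = 1" for i by (simp add: g_def lower_ind_def)
  have g2: "comm_form n h U V f g = 2 * comm_form n h U V f (lower_ind l)" for f
    unfolding g_def by (subst comm_form_affine_right[OF U V]) simp
  have 1: "cmod (comm_form n h U V f (lower_ind l)) \<le> (\<Sum>i<n. f i)"
    if "\<And>i. i < n \<Longrightarrow> f i * f i = f i" for f
    using cmod_comm_form_projection_reflection_le[OF U V, of f g h, OF that g1 h] unfolding g2
    by (simp add: norm_mult)
  have "(\<Sum>i<n. lower_ind k i) = real (card {..<k})"
    using k unfolding lower_ind_def of_bool_def
    by (simp add: sum.If_cases Int_absorb1 Collect_conj_eq[symmetric] flip: lessThan_def)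
  then have a: "cmod (comm_form n h U V (lower_ind k) (lower_ind l)) \<le> real k"
    and s: "(\<Sum>i<n. lower_ind k i) = real k"
    using 1[of "lower_ind k"] by (auto simp: lower_ind_def)
  have "comm_form n h U V (\<lambda>i. 1 + (- 1) * lower_ind k i) (lower_ind l)
      = - comm_form n h U V (lower_ind k) (lower_ind l)"
    by (subst comm_form_affine_left[OF U V]) simp
  moreover have "(\<Sum>i<n. 1 + (- 1) * lower_ind k i) = real (n - k)"
    using s k by (simp add: sum_subtractf of_nat_diff)
  ultimately have "cmod (comm_form n h U V (lower_ind k) (lower_ind l)) \<le> real (n - k)"
    using 1[of "\<lambda>i. 1 + (- 1) * lower_ind k i"] by (auto simp: lower_ind_def)
  with a show ?thesis by (simp add: corank_def)
qed

text \<open>Three bounds meet: the rank bound for either projection, the second through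
  antisymmetry, and \<open>m / 2\<close> from turning both into reflections, which multiplies the
  form by 4.\<close>

lemma cmod_comm_form_lower_ind_le_min:
  assumes U: "U \<in> unitary_mats n" and V: "V \<in> unitary_mats n"
    and h: "\<And>i. i < n \<Longrightarrow> \<bar>h i\<bar> \<le> 1" and hm: "(\<Sum>i<n. \<bar>h i\<bar>) \<le> real m"
    and k: "k \<le> n" and l: "l \<le> n"
  shows "cmod (comm_form n h U V (lower_ind k) (lower_ind l))
    \<le> real (min m (2 * min (corank n k) (corank n l))) / 2"
proof -
  define c where "c = cmod (comm_form n h U V (lower_ind k) (lower_ind l))"
  have 1: "c \<le> real (corank n k)"
    unfolding c_def by (rule cmod_comm_form_lower_ind_le[OF U V h k])
  have 2: "c \<le> real (corank n l)"
    using cmod_comm_form_lower_ind_le[OF V U, of h l k, OF h l] comm_form_swap[OF U V, of h "lower_ind l" "lower_ind k"]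
    unfolding c_def by simp
  define f where "f k i = - 1 + 2 * lower_ind k i" for k i
  have f1: "f k i * f k i = 1" for k i by (simp add: f_def lower_ind_def)
  have "comm_form n h U V (f k) (f l) = 4 * comm_form n h U V (lower_ind k) (lower_ind l)"
    unfolding f_def by (subst comm_form_affine_right[OF U V], subst comm_form_affine_left[OF U V]) simp
  then have "4 * c \<le> 2 * real m"
    using cmod_comm_form_reflections_le[OF U V, of "f k" "f l" h, OF f1 f1] hm by (simp add: c_def norm_mult)
  with 1 2 show ?thesis unfolding c_def[symmetric] by (simp add: min_def)
qed

text \<open>Only the layers with \<open>r < k\<close> contain \<open>r\<close>. The constant layer
  is left out, hence the term \<open>l (n - 1)\<close>.\<close>

lemma telescope_lower_ind:
  fixes l :: "nat \<Rightarrow> real"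
  assumes "r < n"
  shows "(\<Sum>k\<in>{1..<n}. (l (k - 1) - l k) * lower_ind k r) = l r - l (n - 1)"
proof -
  have "(\<Sum>k\<in>{1..<n}. (l (k - 1) - l k) * lower_ind k r) = (\<Sum>k\<in>{Suc r..<n}. l (k - 1) - l k)"
    unfolding lower_ind_def by (intro sum.mono_neutral_cong_right) auto
  also have "\<dots> = (\<Sum>k\<in>{r..<n - 1}. l k - l (Suc k))"
    using assms by (intro sum.reindex_bij_witness[of _ Suc "\<lambda>k. k - 1"]) auto
  also have "\<dots> = l r - l (n - 1)"
    using assms sum_Suc_diff'[of r "n - 1" "\<lambda>k. - l k"] by simp
  finally show ?thesis .
qed

text \<open>Layer \<open>k\<close> separates the mirror indices \<open>j\<close> and
  \<open>n - 1 - j\<close> exactly when \<open>j < k <= n - 1 - j\<close>, that is, when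
  \<open>j < corank n k\<close>.\<close>

lemma gap_eq_sum_corank:
  fixes l :: "nat \<Rightarrow> real"
  assumes "j \<le> n - 1 - j" "j < n"
  shows "l j - l (n - 1 - j) = (\<Sum>k\<in>{1..<n}. (l (k - 1) - l k) * of_bool (j < corank n k))"
proof -
  have "l j - l (n - 1 - j)
    = (\<Sum>k\<in>{1..<n}. (l (k - 1) - l k) * (lower_ind k j - lower_ind k (n - 1 - j)))"
    using telescope_lower_ind[of j n l] telescope_lower_ind[of "n - 1 - j" n l] assms
    by (simp add: right_diff_distrib sum_subtractf)
  also have "\<dots> = (\<Sum>k\<in>{1..<n}. (l (k - 1) - l k) * of_bool (j < corank n k))"
    using assms by (intro sum.cong refl) (auto simp: lower_ind_def corank_def)
  finally show ?thesis .
qed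

text \<open>For decreasing spectra these are the singular values attained by the rotation; the
  factor 1/2 is \<open>cos(pi/4) sin(pi/4)\<close>.\<close>

definition half_gap_prod :: "nat \<Rightarrow> (nat \<Rightarrow> real) \<Rightarrow> (nat \<Rightarrow> real) \<Rightarrow> nat \<Rightarrow> real" where
  "half_gap_prod n l d j = (l j - l (n - 1 - j)) * (d j - d (n - 1 - j)) / 2"

text \<open>Since \<open>half_gap_prod n l d\<close> is invariant under \<open>j \<mapsto> n - 1 - j\<close>, the sequence
  \<open>half_gap_prod n l d (i div 2)\<close>, \<open>i < n\<close>, is its decreasing rearrangement.\<close>

lemma sum_half_gap_prod:
  assumes "m \<le> n"
  shows "(\<Sum>i<m. half_gap_prod n l d (i div 2))
    = (\<Sum>k\<in>{1..<n}. \<Sum>j\<in>{1..<n}. (l (k - 1) - l k) * (d (j - 1) - d j) *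
        (real (min m (2 * min (corank n k) (corank n j))) / 2))"
proof -
  have "(\<Sum>i<m. half_gap_prod n l d (i div 2))
    = (\<Sum>i<m. \<Sum>k\<in>{1..<n}. \<Sum>j\<in>{1..<n}. (l (k - 1) - l k) * (d (j - 1) - d j) *
        (of_bool (i < 2 * min (corank n k) (corank n j)) / 2))"
  proof (intro sum.cong refl)
    fix i assume "i \<in> {..<m}"
    then have i: "i div 2 \<le> n - 1 - i div 2" "i div 2 < n" using assms by auto
    \<comment> \<open>\<open>i div 2 < q\<close> is equivalent to \<open>i < 2 * q\<close>, and the
      product of two layer indicators is the indicator for the minimum.\<close>
    show "half_gap_prod n l d (i div 2) = (\<Sum>k\<in>{1..<n}. \<Sum>j\<in>{1..<n}. (l (k - 1) - l k) * (d (j - 1) - d j) *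
        (of_bool (i < 2 * min (corank n k) (corank n j)) / 2))"
      unfolding half_gap_prod_def gap_eq_sum_corank[OF i] sum_product sum_divide_distrib
      by (intro sum.cong refl) auto
  qed
  also have "\<dots> = (\<Sum>k\<in>{1..<n}. \<Sum>j\<in>{1..<n}. \<Sum>i<m. (l (k - 1) - l k) * (d (j - 1) - d j) *
        (of_bool (i < 2 * min (corank n k) (corank n j)) / 2))"
    by (simp only: sum.swap[of _ _ "{..<m}"])
  also have "\<dots> = (\<Sum>k\<in>{1..<n}. \<Sum>j\<in>{1..<n}. (l (k - 1) - l k) * (d (j - 1) - d j) *
        (real (min m (2 * min (corank n k) (corank n j))) / 2))"
  proof (intro sum.cong refl)
    fix k j
    have "(\<Sum>i<m. of_bool (i < q) :: real) = real (min m q)" for q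
    proof -
      have "(\<Sum>i<m. of_bool (i < q) :: real) = real (card ({..<m} \<inter> {i. i < q}))"
        by (simp add: of_bool_def sum.If_cases)
      also have "{..<m} \<inter> {i. i < q} = {..<min m q}" by auto
      finally show ?thesis by simp
    qed
    then show "(\<Sum>i<m. (l (k - 1) - l k) * (d (j - 1) - d j) *
        (of_bool (i < 2 * min (corank n k) (corank n j)) / 2))
      = (l (k - 1) - l k) * (d (j - 1) - d j) *
        (real (min m (2 * min (corank n k) (corank n j))) / 2)"
      by (simp only: sum_distrib_left[symmetric] sum_divide_distrib[symmetric])
  qed
  finally show ?thesis .
qed

text \<open>Both spectra are expanded in layers whose coefficients, the successive drops, are
  nonnegative. The triangle inequality and the bound for each pair of layers add up to exactly the
  layer expansion of the prefix sum.\<close>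

lemma cmod_comm_form_le_sum_half_gap_prod:
  assumes U: "U \<in> unitary_mats n" and V: "V \<in> unitary_mats n"
    and h: "\<And>i. i < n \<Longrightarrow> \<bar>h i\<bar> \<le> 1" and hm: "(\<Sum>i<n. \<bar>h i\<bar>) \<le> real m" and m: "m \<le> n"
    and l: "\<And>i j. i \<le> j \<Longrightarrow> j < n \<Longrightarrow> l j \<le> l i"
    and d: "\<And>i j. i \<le> j \<Longrightarrow> j < n \<Longrightarrow> d j \<le> d i"
  shows "cmod (comm_form n h U V l d) \<le> (\<Sum>i<m. half_gap_prod n l d (i div 2))"
proof -
  define lf where "lf k = l (k - 1) - l k" for k
  define df where "df k = d (k - 1) - d k" for k
  have lf: "0 \<le> lf k" and df: "0 \<le> df k" if "k \<in> {1..<n}" for k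
    using that l[of "k - 1" k] d[of "k - 1" k] by (auto simp: lf_def df_def)
  have layer: "f r = f (n - 1) + 1 * (\<Sum>k\<in>{1..<n}. (f (k - 1) - f k) * lower_ind k r)"
    if "r < n" for r and f :: "nat \<Rightarrow> real"
    using telescope_lower_ind[OF that, of f] by simp
  have "comm_form n h U V l d = comm_form n h U V (\<lambda>r. \<Sum>k\<in>{1..<n}. lf k * lower_ind k r) d"
    by (subst comm_form_cong_left[OF U V layer], assumption, subst comm_form_affine_left[OF U V])
       (simp add: lf_def)
  also have "\<dots> = (\<Sum>k\<in>{1..<n}. complex_of_real (lf k) * comm_form n h U V (lower_ind k) d)"
    by (rule comm_form_sum_left[OF U V])
  also have "\<dots> = (\<Sum>k\<in>{1..<n}. \<Sum>j\<in>{1..<n}. complex_of_real (lf k) *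
      (complex_of_real (df j) * comm_form n h U V (lower_ind k) (lower_ind j)))"
  proof (intro sum.cong refl)
    fix k
    \<comment> \<open>The layers of \<open>d\<close> are inserted in the left slot and carried to
      the right by antisymmetry.\<close>
    have "comm_form n h V U d (lower_ind k)
        = comm_form n h V U (\<lambda>r. \<Sum>j\<in>{1..<n}. df j * lower_ind j r) (lower_ind k)"
      by (subst comm_form_cong_left[OF V U layer], assumption, subst comm_form_affine_left[OF V U])
         (simp add: df_def)
    then have "comm_form n h U V (lower_ind k) d
        = comm_form n h U V (lower_ind k) (\<lambda>r. \<Sum>j\<in>{1..<n}. df j * lower_ind j r)"
      by (simp only: comm_form_swap[OF V U, of h "lower_ind k"])
    then show "complex_of_real (lf k) * comm_form n h U V (lower_ind k) d
      = (\<Sum>j\<in>{1..<n}. complex_of_real (lf k) *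
        (complex_of_real (df j) * comm_form n h U V (lower_ind k) (lower_ind j)))"
      by (simp add: comm_form_sum_right[OF U V] sum_distrib_left)
  qed
  finally have eq: "comm_form n h U V l d = (\<Sum>k\<in>{1..<n}. \<Sum>j\<in>{1..<n}. complex_of_real (lf k) *
      (complex_of_real (df j) * comm_form n h U V (lower_ind k) (lower_ind j)))" .
  have "cmod (comm_form n h U V l d) \<le> (\<Sum>k\<in>{1..<n}. \<Sum>j\<in>{1..<n}. lf k * df j *
        (real (min m (2 * min (corank n k) (corank n j))) / 2))"
    unfolding eq
  proof (intro sum_norm_le)
    fix k j assume kj: "k \<in> {1..<n}" "j \<in> {1..<n}"
    then have "cmod (comm_form n h U V (lower_ind k) (lower_ind j))
      \<le> real (min m (2 * min (corank n k) (corank n j))) / 2"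
      by (intro cmod_comm_form_lower_ind_le_min[OF U V h hm]) auto
    with lf[OF kj(1)] df[OF kj(2)]
    show "cmod (complex_of_real (lf k) * (complex_of_real (df j) * comm_form n h U V (lower_ind k) (lower_ind j)))
      \<le> lf k * df j * (real (min m (2 * min (corank n k) (corank n j))) / 2)"
      by (simp only: norm_mult norm_of_real abs_of_nonneg mult.assoc mult_left_mono mult_nonneg_nonneg)
  qed
  also have "\<dots> = (\<Sum>i<m. half_gap_prod n l d (i div 2))"
    unfolding lf_def df_def by (rule sum_half_gap_prod[OF m, of l d, symmetric])
  finally show ?thesis .
qed

section \<open>Weak majorization for symmetric gauge functions\<close>

text \<open>Induction on the number of indices with \<open>x\<^sub>i \<noteq> y\<^sub>i\<close>: averaging \<open>y\<close> with a sign flip or a transposition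
  of itself does not increase \<open>\<Phi>\<close>, keeps the prefix sums dominating and makes one more entry agree.\<close>

lemma symmetric_gauge_weak_majorization:
  fixes \<Phi> :: "(nat \<Rightarrow> real) \<Rightarrow> real"
  assumes ext: "\<And>x y. (\<And>i. i < n \<Longrightarrow> x i = y i) \<Longrightarrow> \<Phi> x = \<Phi> y"
    and conv: "\<And>c x y. 0 \<le> c \<Longrightarrow> c \<le> 1 \<Longrightarrow>
      \<Phi> (\<lambda>i. c * x i + (1 - c) * y i) \<le> c * \<Phi> x + (1 - c) * \<Phi> y"
    and swap: "\<And>x j k. j < n \<Longrightarrow> k < n \<Longrightarrow> \<Phi> (x \<circ> Transposition.transpose j k) = \<Phi> x"
    and flip: "\<And>x k. k < n \<Longrightarrow> \<Phi> (x(k := - x k)) = \<Phi> x"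
    and x0: "\<And>i. i < n \<Longrightarrow> 0 \<le> x i"
    and xdec: "\<And>i j. i \<le> j \<Longrightarrow> j < n \<Longrightarrow> x j \<le> x i"
    and prefix: "\<And>m. m \<le> n \<Longrightarrow> (\<Sum>i<m. x i) \<le> (\<Sum>i<m. y i)"
  shows "\<Phi> x \<le> \<Phi> y"
  using prefix
proof (induction "card {i. i < n \<and> x i \<noteq> y i}" arbitrary: y rule: less_induct)
  case less
  \<comment> \<open>\<open>y'\<close> mixes \<open>y\<close> with some \<open>z\<close> of equal
    \<Phi>-value, so convexity gives \<open>\<Phi> y' \<le> \<Phi> y\<close>, and the induction
    hypothesis applies to \<open>y'\<close>.\<close>
  have step: "\<Phi> x \<le> \<Phi> y"
    if inv: "\<Phi> (z \<circ> id) = \<Phi> y" and c: "0 \<le> c" "c \<le> 1"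
      and y': "\<And>i. i < n \<Longrightarrow> y' i = c * y i + (1 - c) * z i"
      and fewer: "{i. i < n \<and> x i \<noteq> y' i} \<subset> {i. i < n \<and> x i \<noteq> y i}"
      and pre: "\<And>m. m \<le> n \<Longrightarrow> (\<Sum>i<m. x i) \<le> (\<Sum>i<m. y' i)" for z c y'
  proof -
    have "\<Phi> x \<le> \<Phi> y'"
      by (rule less.hyps[OF psubset_card_mono[OF _ fewer] pre]) auto
    also have "\<Phi> y' = \<Phi> (\<lambda>i. c * y i + (1 - c) * z i)" using y' by (intro ext) auto
    also have "\<dots> \<le> c * \<Phi> y + (1 - c) * \<Phi> z" by (rule conv[OF c])
    also have "\<dots> = \<Phi> y" using inv by (simp add: algebra_simps)
    finally show ?thesis .
  qed
  consider (eq) "\<forall>i<n. x i = y i"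
    | (below) "\<forall>i<n. x i \<le> y i" "\<exists>k<n. x k < y k"
    | (above) "\<exists>k<n. y k < x k"
    by (metis less_eq_real_def not_le)
  then show ?case
  proof cases
    case eq
    then show ?thesis using ext[of x y] by auto
  next
    case below
    then obtain k where k: "k < n" "x k < y k" by blast
    have pos: "0 < y k" using k x0[of k] by linarith
    \<comment> \<open>The weight for which mixing \<open>y k\<close> with \<open>- y k\<close> gives
      \<open>x k\<close>; it lies in the unit interval because
      \<open>0 \<le> x k < y k\<close>.\<close>
    define c where "c = (x k + y k) / (2 * y k)"
    have c: "0 \<le> c" "c \<le> 1" using k x0[of k] pos by (auto simp: c_def field_simps)
    have ck: "c * y k + (1 - c) * (- y k) = x k" using pos by (simp add: c_def field_simps)
    show ?thesis
    proof (rule step[of "y(k := - y k)" c "y(k := x k)"])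
      show "\<Phi> (y(k := - y k) \<circ> id) = \<Phi> y" using flip[OF k(1)] by simp
      show "(y(k := x k)) i = c * y i + (1 - c) * (y(k := - y k)) i" if "i < n" for i
        using ck by (auto simp: algebra_simps)
      have "{i. i < n \<and> x i \<noteq> (y(k := x k)) i} = {i. i < n \<and> x i \<noteq> y i} - {k}" by auto
      moreover have "k \<in> {i. i < n \<and> x i \<noteq> y i}" using k by simp
      ultimately show "{i. i < n \<and> x i \<noteq> (y(k := x k)) i} \<subset> {i. i < n \<and> x i \<noteq> y i}"
        by blast
      show "(\<Sum>i<m. x i) \<le> (\<Sum>i<m. (y(k := x k)) i)" if "m \<le> n" for m
        using that below(1) by (intro sum_mono) auto
    qed (use c in auto)
  next
    case above
    \<comment> \<open>The first index where \<open>y\<close> falls short. The prefix sum through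
      \<open>k\<close> still dominates, so some earlier entry has a surplus.\<close>
    define k where "k = (LEAST k. k < n \<and> y k < x k)"
    have k: "k < n" "y k < x k" using LeastI_ex[of "\<lambda>k. k < n \<and> y k < x k"] above
      by (auto simp: k_def)
    have bk: "x i \<le> y i" if "i < k" for i
      using not_less_Least[of i "\<lambda>k. k < n \<and> y k < x k"] that k by (auto simp: k_def)
    have "\<exists>j<k. x j < y j"
    proof (rule ccontr)
      assume "\<not> ?thesis"
      then have "(\<Sum>i<k. y i) \<le> (\<Sum>i<k. x i)" by (intro sum_mono) auto
      then have "(\<Sum>i<Suc k. y i) < (\<Sum>i<Suc k. x i)" using k by simp
      with less.prems[of "Suc k"] k show False by simp
    qed
    then obtain j where j: "j < k" "x j < y j" by blast
    have jk: "x k \<le> x j" using xdec[of j k] j k by simp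
    \<comment> \<open>The largest transfer from \<open>j\<close> to \<open>k\<close> that overshoots
      neither \<open>x j\<close> nor \<open>x k\<close>; one of the two entries then agrees.\<close>
    define \<delta> where "\<delta> = min (y j - x j) (x k - y k)"
    have \<delta>: "0 < \<delta>" "\<delta> \<le> y j - x j" "\<delta> \<le> x k - y k" using j k by (auto simp: \<delta>_def)
    \<comment> \<open>With this weight, averaging \<open>y\<close> with its transposition moves
      exactly \<delta> from \<open>j\<close> to \<open>k\<close>.\<close>
    define c where "c = 1 - \<delta> / (y j - y k)"
    have gap: "\<delta> \<le> y j - y k" "0 < y j - y k" using \<delta> j k jk by linarith+
    have c: "0 \<le> c" "c \<le> 1" using \<delta> gap by (auto simp: c_def field_simps)
    have cj: "c * y j + (1 - c) * y k = y j - \<delta>" "c * y k + (1 - c) * y j = y k + \<delta>"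
    proof -
      have "(1 - c) * (y j - y k) = \<delta>" using gap by (simp add: c_def)
      then show "c * y j + (1 - c) * y k = y j - \<delta>" "c * y k + (1 - c) * y j = y k + \<delta>"
        by (simp_all add: algebra_simps)
    qed
    define y' where "y' = y(j := y j - \<delta>, k := y k + \<delta>)"
    have y'_alt: "y' i = y i - \<delta> * of_bool (i = j) + \<delta> * of_bool (i = k)" for i
      using j by (auto simp: y'_def)
    show ?thesis
    proof (rule step[of "y \<circ> Transposition.transpose j k" c y'])
      show "\<Phi> (y \<circ> Transposition.transpose j k \<circ> id) = \<Phi> y" using swap[of j k y] j k by simp
      show "y' i = c * y i + (1 - c) * (y \<circ> Transposition.transpose j k) i" if "i < n" for i
      proof -
        consider "i = j" | "i = k" | "i \<noteq> j" "i \<noteq> k" by blast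
        then show ?thesis using cj j by cases (auto simp: y'_def algebra_simps)
      qed
      have "x j = y' j \<or> x k = y' k" using j by (auto simp: y'_def \<delta>_def min_def)
      moreover have "j \<in> {i. i < n \<and> x i \<noteq> y i}" "k \<in> {i. i < n \<and> x i \<noteq> y i}"
        using j k by simp_all
      moreover have "y' i = y i" if "i \<noteq> j" "i \<noteq> k" for i using that by (simp add: y'_def)
      ultimately show "{i. i < n \<and> x i \<noteq> y' i} \<subset> {i. i < n \<and> x i \<noteq> y i}"
        by fastforce
      show "(\<Sum>i<m. x i) \<le> (\<Sum>i<m. y' i)" if m: "m \<le> n" for m
      proof -
        have ysum: "(\<Sum>i<m. y' i) = (\<Sum>i<m. y i) - \<delta> * of_bool (j < m) + \<delta> * of_bool (k < m)"
          by (simp add: y'_alt sum.distrib sum_subtractf flip: sum_distrib_left)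
        show ?thesis
        \<comment> \<open>Only prefixes with \<open>j < m \<le> k\<close> lose \<delta>. All their
          entries dominate, so the surplus at \<open>j\<close> alone covers the loss.\<close>
        proof (cases "j < m \<and> m \<le> k")
          case True
          have "\<delta> \<le> y j - x j" by (rule \<delta>)
          also have "\<dots> \<le> (\<Sum>i<m. y i - x i)"
            using True bk by (intro member_le_sum) auto
          finally show ?thesis using ysum True by (simp add: sum_subtractf)
        next
          case False
          then show ?thesis using ysum less.prems[OF m] j by auto
        qed
      qed
    qed (use c in auto)
  qed
qed

lemma exists_antimono_bij:
  fixes f :: "nat \<Rightarrow> real"
  obtains p where "bij_betw p {..<n} {..<n}" "\<And>i j. i \<le> j \<Longrightarrow> j < n \<Longrightarrow> f (p j) \<le> f (p i)"
proof -
  define ys where "ys = sort_key (\<lambda>i. - f i) [0..<n]"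
  have len: "length ys = n" by (simp add: ys_def)
  have bij: "bij_betw (\<lambda>i. ys ! i) {..<n} {..<n}"
    by (rule bij_betw_nth) (auto simp: ys_def)
  have sorted: "sorted (map (\<lambda>i. - f i) ys)" by (simp add: ys_def)
  have "f (ys ! j) \<le> f (ys ! i)" if "i \<le> j" "j < n" for i j
    using sorted_nth_mono[OF sorted that(1)] that len by simp
  with bij show ?thesis by (rule that)
qed

section \<open>Unitarily invariant norms of commutators\<close>

definition perm_mat :: "nat \<Rightarrow> (nat \<Rightarrow> nat) \<Rightarrow> complex mat" where
  "perm_mat n p = mat n n (\<lambda>(i, j). of_bool (i = p j))"

lemma perm_mat_carrier [simp]: "perm_mat n p \<in> carrier_mat n n"
  by (simp add: perm_mat_def)

lemma mult_perm_mat_index: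
  assumes "X \<in> carrier_mat n n" "i < n" "j < n" "p j < n"
  shows "(X * perm_mat n p) $$ (i, j) = X $$ (i, p j)"
proof -
  have "(X * perm_mat n p) $$ (i, j) = (\<Sum>r<n. X $$ (i, r) * of_bool (r = p j))"
    using assms by (subst index_mult_mat_sum[of _ n n _ n]) (auto simp: perm_mat_def)
  also have "\<dots> = (\<Sum>r<n. if r = p j then X $$ (i, r) else 0)"
    by (intro sum.cong refl) simp
  also have "\<dots> = X $$ (i, p j)" using assms(4) by simp
  finally show ?thesis .
qed

lemma perm_mat_unitary:
  assumes p: "bij_betw p {..<n} {..<n}"
  shows "perm_mat n p \<in> unitary_mats n"
proof -
  have inj: "p i = p j \<longleftrightarrow> i = j" if "i < n" "j < n" for i j
    using bij_betw_imp_inj_on[OF p] that by (auto simp: inj_on_def)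
  have lt: "p i < n" if "i < n" for i using bij_betwE[OF p] that by auto
  have "mat_adjoint (perm_mat n p) * perm_mat n p = 1\<^sub>m n"
  proof (rule eq_matI)
    fix i j assume "i < dim_row (1\<^sub>m n)" "j < dim_col (1\<^sub>m n)"
    then have ij: "i < n" "j < n" by auto
    then have "(mat_adjoint (perm_mat n p) * perm_mat n p) $$ (i, j) = mat_adjoint (perm_mat n p) $$ (i, p j)"
      by (intro mult_perm_mat_index lt) auto
    also have "\<dots> = 1\<^sub>m n $$ (i, j)"
      using ij lt[OF ij(2)] inj by (subst mat_adjoint_index) (auto simp: perm_mat_def)
    finally show "(mat_adjoint (perm_mat n p) * perm_mat n p) $$ (i, j) = 1\<^sub>m n $$ (i, j)" .
  qed (auto simp: perm_mat_def)
  then show ?thesis by (simp add: unitary_mats_iff)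
qed

context
  fixes n :: nat and N :: "complex mat \<Rightarrow> real"
  assumes N: "unitarily_invariant_norm n N"
begin

lemma uinorm_unitary_left:
  assumes "U \<in> unitary_mats n" "X \<in> carrier_mat n n"
  shows "N (U * X) = N X"
proof -
  have "N (U * X * 1\<^sub>m n) = N X"
    using N assms unitary_mats_one[of n] unfolding unitarily_invariant_norm_def by blast
  then show ?thesis using assms unitary_mats_carrier[OF assms(1)]
    by (simp add: right_mult_one_mat[of _ n n] mult_carrier_mat[of _ n n])
qed

lemma uinorm_unitary_right:
  assumes "U \<in> unitary_mats n" "X \<in> carrier_mat n n"
  shows "N (X * U) = N X"
proof -
  have "N (1\<^sub>m n * X * U) = N X"
    using N assms unitary_mats_one[of n] unfolding unitarily_invariant_norm_def by blast
  then show ?thesis using assms by simp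
qed

lemma uinorm_smult:
  "X \<in> carrier_mat n n \<Longrightarrow> N (c \<cdot>\<^sub>m X) = cmod c * N X"
  using N unfolding unitarily_invariant_norm_def mat_norm_on_def by blast

lemma uinorm_triangle:
  "X \<in> carrier_mat n n \<Longrightarrow> Y \<in> carrier_mat n n \<Longrightarrow> N (X + Y) \<le> N X + N Y"
  using N unfolding unitarily_invariant_norm_def mat_norm_on_def by blast

text \<open>The permutation matrix \<open>P\<close> satisfies
  \<open>P diag(x \<circ> p) = diag(x) P\<close>, and the norm ignores a unitary factor on either
  side.\<close>

lemma uinorm_rdiag_permute:
  assumes p: "bij_betw p {..<n} {..<n}"
  shows "N (rdiag n (x \<circ> p)) = N (rdiag n x)"
proof -
  let ?P = "perm_mat n p"
  have inj: "p i = p j \<longleftrightarrow> i = j" if "i < n" "j < n" for i j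
    using bij_betw_imp_inj_on[OF p] that by (auto simp: inj_on_def)
  have lt: "p i < n" if "i < n" for i using bij_betwE[OF p] that by auto
  have "?P * rdiag n (x \<circ> p) = rdiag n x * ?P"
  proof (rule eq_matI)
    fix i j assume "i < dim_row (rdiag n x * ?P)" "j < dim_col (rdiag n x * ?P)"
    then have ij: "i < n" "j < n" by (auto simp: perm_mat_def)
    have "(?P * rdiag n (x \<circ> p)) $$ (i, j) = ?P $$ (i, j) * complex_of_real (x (p j))"
      using ij by (simp add: rdiag_def mat_diag_mult_right[of _ n n])
    moreover have "(rdiag n x * ?P) $$ (i, j) = rdiag n x $$ (i, p j)"
      using ij lt by (intro mult_perm_mat_index) auto
    ultimately show "(?P * rdiag n (x \<circ> p)) $$ (i, j) = (rdiag n x * ?P) $$ (i, j)"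
      using ij lt by (simp add: perm_mat_def)
  qed (auto simp: perm_mat_def)
  then show ?thesis
    using uinorm_unitary_left[OF perm_mat_unitary[OF p], of "rdiag n (x \<circ> p)"]
      uinorm_unitary_right[OF perm_mat_unitary[OF p], of "rdiag n x"] by simp
qed

lemma uinorm_diag_phase:
  assumes "\<And>i. i < n \<Longrightarrow> cmod (s i) = 1"
  shows "N (mat_diag n (\<lambda>i. s i * complex_of_real (x i))) = N (rdiag n x)"
proof -
  have "mat_adjoint (mat_diag n s) = mat_diag n (\<lambda>i. cnj (s i))"
    by (rule eq_matI) (auto simp: mat_diag_def)
  then have "mat_adjoint (mat_diag n s) * mat_diag n s = mat_diag n (\<lambda>i. cnj (s i) * s i)" by simp
  also have "\<dots> = 1\<^sub>m n"
    using assms by (intro eq_matI) (auto simp: mat_diag_def cnj_mult_self)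
  finally have "mat_diag n s \<in> unitary_mats n" by (simp add: unitary_mats_iff)
  from uinorm_unitary_left[OF this, of "rdiag n x"] show ?thesis by (simp add: rdiag_def)
qed

lemma uinorm_rdiag_abs: "N (rdiag n (\<lambda>i. \<bar>x i\<bar>)) = N (rdiag n x)"
proof -
  have "rdiag n (\<lambda>i. \<bar>x i\<bar>)
      = mat_diag n (\<lambda>i. (if 0 \<le> x i then 1 else - 1) * complex_of_real (x i))"
    unfolding rdiag_def by (intro arg_cong[of _ _ "mat_diag n"]) auto
  then show ?thesis by (simp add: uinorm_diag_phase)
qed

lemma uinorm_rdiag_convex:
  assumes "0 \<le> c" "c \<le> 1"
  shows "N (rdiag n (\<lambda>i. c * x i + (1 - c) * y i)) \<le> c * N (rdiag n x) + (1 - c) * N (rdiag n y)"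
proof -
  have "rdiag n (\<lambda>i. c * x i + (1 - c) * y i)
      = complex_of_real c \<cdot>\<^sub>m rdiag n x + complex_of_real (1 - c) \<cdot>\<^sub>m rdiag n y"
    by (rule eq_matI) auto
  also have "N \<dots> \<le> N (complex_of_real c \<cdot>\<^sub>m rdiag n x) + N (complex_of_real (1 - c) \<cdot>\<^sub>m rdiag n y)"
    by (rule uinorm_triangle) auto
  also have "\<dots> = c * N (rdiag n x) + (1 - c) * N (rdiag n y)"
    using assms by (simp only: uinorm_smult rdiag_carrier norm_of_real abs_of_nonneg diff_ge_0_iff_ge)
  finally show ?thesis .
qed

text \<open>The hypothesis is weak majorization in dual form: over all admissible \<open>h\<close>
  the left-hand side has as supremum the sum of the \<open>m\<close> largest \<open>|k i|\<close>.
  Sorting absolute values keeps the norm and reduces to the gauge function lemma.\<close>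

lemma uinorm_rdiag_weak_majorization:
  assumes maj: "\<And>h m. m \<le> n \<Longrightarrow> (\<And>i. i < n \<Longrightarrow> \<bar>h i\<bar> \<le> 1) \<Longrightarrow> (\<Sum>i<n. \<bar>h i\<bar>) \<le> real m
      \<Longrightarrow> (\<Sum>i<n. h i * k i) \<le> (\<Sum>i<m. t i)"
  shows "N (rdiag n k) \<le> N (rdiag n t)"
proof -
  obtain p where p: "bij_betw p {..<n} {..<n}"
    and dec: "\<And>i j. i \<le> j \<Longrightarrow> j < n \<Longrightarrow> \<bar>k (p j)\<bar> \<le> \<bar>k (p i)\<bar>"
    by (rule exists_antimono_bij[of n "\<lambda>i. \<bar>k i\<bar>"]) (rule that)
  define x where "x = (\<lambda>i. \<bar>k i\<bar>) \<circ> p"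
  have "N (rdiag n x) \<le> N (rdiag n t)"
  proof (rule symmetric_gauge_weak_majorization[of n "\<lambda>x. N (rdiag n x)" x t])
    show "N (rdiag n y) = N (rdiag n z)" if "\<And>i. i < n \<Longrightarrow> y i = z i" for y z
      using that by (intro arg_cong[of _ _ N] eq_matI) auto
    show "N (rdiag n (y \<circ> Transposition.transpose i j)) = N (rdiag n y)" if "i < n" "j < n" for y i j
      using that by (intro uinorm_rdiag_permute bij_betw_transpose_iff) auto
    show "N (rdiag n (y(j := - y j))) = N (rdiag n y)" if "j < n" for y j
    proof -
      have "(\<lambda>i. \<bar>(y(j := - y j)) i\<bar>) = (\<lambda>i. \<bar>y i\<bar>)" by auto
      then show ?thesis
        using uinorm_rdiag_abs[of "y(j := - y j)"] uinorm_rdiag_abs[of y] by simp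
    qed
    show "(\<Sum>i<m. x i) \<le> (\<Sum>i<m. t i)" if m: "m \<le> n" for m
    proof -
      \<comment> \<open>The extremal test vector: the signs of \<open>k\<close> at the positions of
        the \<open>m\<close> largest absolute values. Zeros of \<open>k\<close> get weight 0, so the
        total weight can be below \<open>m\<close>.\<close>
      define h where "h i = of_bool (i \<in> p ` {..<m}) * sgn (k i)" for i
      have inj: "inj_on p {..<m}"
        using inj_on_subset[OF bij_betw_imp_inj_on[OF p]] m by auto
      have sub: "p ` {..<m} \<subseteq> {..<n}" using bij_betwE[OF p] m by auto
      have "(\<Sum>i<m. x i) = (\<Sum>i\<in>p ` {..<m}. \<bar>k i\<bar>)"
        by (simp add: sum.reindex[OF inj] x_def)
      also have "\<dots> = (\<Sum>i<n. h i * k i)"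
        using sub by (intro sum.mono_neutral_cong_left) (auto simp: h_def abs_sgn mult.commute)
      also have "\<dots> \<le> (\<Sum>i<m. t i)"
      proof (rule maj[OF m])
        show "\<bar>h i\<bar> \<le> 1" for i by (auto simp: h_def abs_mult sgn_if)
        have "(\<Sum>i<n. \<bar>h i\<bar>) \<le> (\<Sum>i<n. if i \<in> p ` {..<m} then 1 else 0)"
          by (intro sum_mono) (auto simp: h_def abs_mult sgn_if)
        also have "\<dots> = real (card (p ` {..<m}))"
          using sub by (subst sum.If_cases) (auto simp: Int_absorb1)
        also have "\<dots> = real m" by (simp add: card_image[OF inj])
        finally show "(\<Sum>i<n. \<bar>h i\<bar>) \<le> real m" .
      qed
      finally show ?thesis .
    qed
  qed (auto simp: x_def uinorm_rdiag_convex dec)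
  then show ?thesis
    unfolding x_def uinorm_rdiag_permute[OF p] uinorm_rdiag_abs .
qed

end

section \<open>Upper bound for an arbitrary commutator\<close>

lemma spectral_mat_conj:
  assumes "W \<in> carrier_mat n n" "U \<in> carrier_mat n n"
  shows "spectral_mat n (W * U) f = W * spectral_mat n U f * mat_adjoint W"
  using assms by (simp add: spectral_mat_def mat_adjoint_mult[of _ n n _ n] assoc_mult_mat[of _ n n _ n _ n]
    mult_carrier_mat[of _ n n])

lemma mat_commutator_conj:
  assumes W: "W \<in> unitary_mats n" and X: "X \<in> carrier_mat n n" and Y: "Y \<in> carrier_mat n n"
  shows "mat_commutator (W * X * mat_adjoint W) (W * Y * mat_adjoint W) = W * mat_commutator X Y * mat_adjoint W"
proof -
  note Wc = unitary_mats_carrier[OF W]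
  have "W * X * mat_adjoint W * (W * Y * mat_adjoint W) = W * (X * Y) * mat_adjoint W"
    if X: "X \<in> carrier_mat n n" and Y: "Y \<in> carrier_mat n n" for X Y
    using X Y Wc by (simp add: assoc_mult_mat[of _ n n _ n _ n] mult_carrier_mat[of _ n n]
      unitary_mats_cancel(1)[OF W, of _ n])
  then show ?thesis
    using X Y Wc by (simp add: mat_commutator_def mult_minus_distrib_mat[of _ n n _ n]
      minus_mult_distrib_mat[of _ n n _ _ n] mult_carrier_mat[of _ n n])
qed

text \<open>The commutator \<open>C\<close> is skew-Hermitian, so \<open>\<i> C\<close> is Hermitian
  and has the same norm. In its eigenbasis the eigenvalues stand on the diagonal, and each test sum
  \<open>\<Sum> h k\<close> is \<i> times a value of \<open>comm_form\<close>.\<close>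

lemma uinorm_commutator_spectral_le:
  assumes N: "unitarily_invariant_norm n N"
    and P: "P \<in> unitary_mats n" and U: "U \<in> unitary_mats n"
    and l: "\<And>i j. i \<le> j \<Longrightarrow> j < n \<Longrightarrow> l j \<le> l i"
    and d: "\<And>i j. i \<le> j \<Longrightarrow> j < n \<Longrightarrow> d j \<le> d i"
  shows "N (mat_commutator (spectral_mat n P l) (spectral_mat n U d))
    \<le> N (rdiag n (\<lambda>i. half_gap_prod n l d (i div 2)))"
proof -
  define A where "A = spectral_mat n P l"
  define B where "B = spectral_mat n U d"
  define C where "C = mat_commutator A B"
  have A: "A \<in> carrier_mat n n" "mat_adjoint A = A"
    unfolding A_def using unitary_mats_carrier[OF P] by (auto intro: spectral_mat_carrier spectral_mat_adjoint)
  have B: "B \<in> carrier_mat n n" "mat_adjoint B = B"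
    unfolding B_def using unitary_mats_carrier[OF U] by (auto intro: spectral_mat_carrier spectral_mat_adjoint)
  have C: "C \<in> carrier_mat n n" unfolding C_def by (intro mat_commutator_carrier A B)
  have "mat_adjoint C = B * A - A * B"
    unfolding C_def mat_commutator_def using A B
    by (simp add: mat_adjoint_minus[of _ n n] mat_adjoint_mult[of _ n n _ n] mult_carrier_mat[of _ n n])
  then have "mat_adjoint (\<i> \<cdot>\<^sub>m C) = \<i> \<cdot>\<^sub>m C"
    unfolding mat_adjoint_smult using A B
    by (intro eq_matI) (auto simp: C_def mat_commutator_def algebra_simps)
  then have "hermitian_mat (\<i> \<cdot>\<^sub>m C)" by (simp add: hermitian_mat_def)
  with C obtain W k where W: "W \<in> unitary_mats n" and k: "mat_adjoint W * (\<i> \<cdot>\<^sub>m C) * W = rdiag n k"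
    using hermitian_unitary_diagonalization[of "\<i> \<cdot>\<^sub>m C" n] unfolding rdiag_def by auto
  note Wc = unitary_mats_carrier[OF W] and W' = unitary_mats_adjoint[OF W]
  note W'c = unitary_mats_carrier[OF W']
  have "N (rdiag n k) = N (\<i> \<cdot>\<^sub>m C)"
    unfolding k[symmetric] using C Wc W'c
    by (simp add: uinorm_unitary_right[OF N W] uinorm_unitary_left[OF N W'] mult_carrier_mat[of _ n n])
  then have NC: "N C = N (rdiag n k)" using C by (simp add: uinorm_smult[OF N])
  \<comment> \<open>The change of basis by \<open>W\<close> is absorbed into the two eigenbases; the
    spectra \<open>l\<close> and \<open>d\<close> stay as they are.\<close>
  define P' where "P' = mat_adjoint W * P"
  define U' where "U' = mat_adjoint W * U"
  have P': "P' \<in> unitary_mats n" and U': "U' \<in> unitary_mats n"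
    unfolding P'_def U'_def by (intro unitary_mats_mult W' P U)+
  have comm: "mat_commutator (spectral_mat n P' l) (spectral_mat n U' d) = mat_adjoint W * C * W"
    using mat_commutator_conj[OF W' A(1) B(1)]
    unfolding P'_def U'_def spectral_mat_conj[OF W'c unitary_mats_carrier[OF P]]
      spectral_mat_conj[OF W'c unitary_mats_carrier[OF U]] A_def[symmetric] B_def[symmetric] C_def[symmetric]
    by simp
  have "mat_adjoint W * (\<i> \<cdot>\<^sub>m C) * W = \<i> \<cdot>\<^sub>m (mat_adjoint W * C * W)"
    using C Wc W'c by (simp add: mult_smult_distrib[of _ n n _ n] mult_smult_assoc_mat[of _ n n _ n] mult_carrier_mat[of _ n n])
  with k have e: "\<i> \<cdot>\<^sub>m (mat_adjoint W * C * W) = rdiag n k" by simp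
  have ki: "complex_of_real (k i) = \<i> * (mat_adjoint W * C * W) $$ (i, i)" if "i < n" for i
  proof -
    have "mat_adjoint W * C * W \<in> carrier_mat n n" by (intro mult_carrier_mat[of _ n n] W'c C Wc)
    then have "(\<i> \<cdot>\<^sub>m (mat_adjoint W * C * W)) $$ (i, i) = \<i> * (mat_adjoint W * C * W) $$ (i, i)"
      using that by (intro index_smult_mat(1)) (auto simp only: carrier_matD)
    then show ?thesis unfolding e using that by simp
  qed
  have "N (rdiag n k) \<le> N (rdiag n (\<lambda>i. half_gap_prod n l d (i div 2)))"
  proof (rule uinorm_rdiag_weak_majorization[OF N])
    fix h m assume m: "m \<le> n" and h: "\<And>i. i < n \<Longrightarrow> \<bar>h i :: real\<bar> \<le> 1" and hm: "(\<Sum>i<n. \<bar>h i\<bar>) \<le> real m"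
    have "complex_of_real (\<Sum>i<n. h i * k i) = \<i> * comm_form n h P' U' l d"
      unfolding comm_form_def comm by (simp add: ki sum_distrib_left mult.left_commute)
    then have "\<bar>\<Sum>i<n. h i * k i\<bar> = cmod (comm_form n h P' U' l d)"
      by (metis norm_mult norm_ii mult_1 norm_of_real)
    also have "\<dots> \<le> (\<Sum>i<m. half_gap_prod n l d (i div 2))"
      by (rule cmod_comm_form_le_sum_half_gap_prod[OF P' U', of h m l d, OF h hm m l d])
    finally show "(\<Sum>i<n. h i * k i) \<le> (\<Sum>i<m. half_gap_prod n l d (i div 2))" by simp
  qed
  then show ?thesis using NC by (simp add: C_def A_def B_def)
qed

text \<open>Mirror symmetry of \<open>half_gap_prod\<close> makes the doubled sequence a
  rearrangement of the plain one.\<close>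

lemma uinorm_rdiag_half_gap_prod:
  assumes N: "unitarily_invariant_norm n N"
  shows "N (rdiag n (\<lambda>i. half_gap_prod n l d (i div 2))) = N (rdiag n (half_gap_prod n l d))"
proof -
  \<comment> \<open>The order \<open>0, n - 1, 1, n - 2, ...\<close> puts mirror indices next to
    each other.\<close>
  define p where "p i = (if even i then i div 2 else n - 1 - i div 2)" for i
  have "inj_on p {..<n}"
  proof (rule inj_onI)
    fix i j assume "i \<in> {..<n}" "j \<in> {..<n}" and e: "p i = p j"
    then have "i < n" "j < n" by auto
    with e show "i = j"
      unfolding p_def by (cases "even i"; cases "even j") (auto elim!: evenE oddE)
  qed
  moreover have "p ` {..<n} \<subseteq> {..<n}" by (auto simp: p_def)
  ultimately have p: "bij_betw p {..<n} {..<n}"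
    by (simp add: bij_betw_def endo_inj_surj)
  have "half_gap_prod n l d (p i) = half_gap_prod n l d (i div 2)" if "i < n" for i
  proof -
    have "n - Suc (n - Suc (i div 2)) = i div 2" using that by auto
    moreover have "(a - b) * (c - e) = (b - a) * (e - c)" for a b c e :: real
      by (simp add: algebra_simps)
    ultimately show ?thesis by (simp add: p_def half_gap_prod_def)
  qed
  then have "rdiag n (half_gap_prod n l d \<circ> p) = rdiag n (\<lambda>i. half_gap_prod n l d (i div 2))"
    by (intro eq_matI) auto
  with uinorm_rdiag_permute[OF N p, of "half_gap_prod n l d"] show ?thesis by simp
qed

section \<open>The rotation matrix and the norm it attains\<close>

definition rot_sign :: "nat \<Rightarrow> nat \<Rightarrow> real" where
  "rot_sign n i = (if i < n div 2 then - 1 else 1)"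

text \<open>The condition \<open>i = n - 1 - i\<close> singles out the central index of odd
  \<open>n\<close>, which spares later computations the parity of \<open>n\<close>.\<close>

lemma rotation_mat_index:
  assumes "i < n" "j < n"
  shows "rotation_mat n \<theta> $$ (i, j) =
    (if i = n - 1 - i then of_bool (j = i)
     else if j = i then cos \<theta> else if j = n - 1 - i then rot_sign n i * sin \<theta> else 0)"
  using assms unfolding rotation_mat_def rot_sign_def
  by (auto elim!: evenE oddE)

lemma rotation_mat_sum:
  assumes i: "i < n"
  shows "(\<Sum>r<n. f r * rotation_mat n \<theta> $$ (i, r)) =
    (if i = n - 1 - i then f i else f i * cos \<theta> + f (n - 1 - i) * (rot_sign n i * sin \<theta>))"
proof -
  have "(\<Sum>r<n. f r * rotation_mat n \<theta> $$ (i, r)) = (\<Sum>r\<in>{i, n - 1 - i}. f r * rotation_mat n \<theta> $$ (i, r))"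
    using i by (intro sum.mono_neutral_right) (auto simp: rotation_mat_index)
  then show ?thesis using i by (auto simp: rotation_mat_index)
qed

text \<open>Entry \<open>(i, j)\<close> of \<open>R diag(f) R^T\<close>. Constant \<open>f\<close>
  gives orthogonality of \<open>R\<close>; \<open>f = d\<close> gives the rotated second matrix,
  whose coupling of mirror indices is \<open>cos sin\<close> times a gap, up to sign.\<close>

lemma rotation_mat_gram:
  assumes i: "i < n" and j: "j < n"
  shows "(\<Sum>r<n. f r * rotation_mat n \<theta> $$ (j, r) * rotation_mat n \<theta> $$ (i, r)) =
    (if j = i then (if i = n - 1 - i then f i else f i * (cos \<theta>)\<^sup>2 + f (n - 1 - i) * (sin \<theta>)\<^sup>2)
     else if j = n - 1 - i then rot_sign n i * (cos \<theta> * sin \<theta>) * (f (n - 1 - i) - f i) else 0)"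
proof -
  \<comment> \<open>Mirror indices lie in opposite halves, the central index excepted.\<close>
  have neg: "rot_sign n (n - 1 - i) = - rot_sign n i" if "i \<noteq> n - 1 - i"
    using that i by (auto simp: rot_sign_def)
  have sq: "rot_sign n i * (rot_sign n i * x) = x" for x by (simp add: rot_sign_def)
  note R = rotation_mat_sum[OF i, of "\<lambda>r. f r * rotation_mat n \<theta> $$ (j, r)"]
  have i': "n - 1 - i < n" "n - 1 - (n - 1 - i) = i" using i by auto
  consider "i = n - 1 - i" | "i \<noteq> n - 1 - i" "j = i" | "i \<noteq> n - 1 - i" "j = n - 1 - i"
    | "i \<noteq> n - 1 - i" "j \<noteq> i" "j \<noteq> n - 1 - i" by blast
  then show ?thesis
  proof cases
    case 1
    then have "j = i" if "i = n - 1 - j" using that j by linarith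
    with 1 show ?thesis unfolding R using i j by (auto simp: rotation_mat_index)
  next
    case 2
    then show ?thesis unfolding R rotation_mat_index[OF j i] rotation_mat_index[OF j i'(1)]
      by (simp add: power2_eq_square sq algebra_simps)
  next
    case 3
    then have F: "i = n - 1 - j" "i \<noteq> j" "j \<noteq> n - 1 - j" using i by linarith+
    have "rotation_mat n \<theta> $$ (j, i) = rot_sign n j * sin \<theta>"
      unfolding rotation_mat_index[OF j i] using F by simp
    moreover have "rotation_mat n \<theta> $$ (j, n - 1 - i) = cos \<theta>"
      unfolding 3(2)[symmetric] using F(3) by (simp only: rotation_mat_index[OF j j] if_False if_True simp_thms)
    moreover have "rot_sign n j = - rot_sign n i" using 3 neg by simp
    ultimately show ?thesis unfolding R using 3 by (simp add: algebra_simps)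
  next
    case 4
    then have "i \<noteq> n - 1 - j" "n - 1 - i \<noteq> n - 1 - j" using i j by linarith+
    with 4 show ?thesis unfolding R rotation_mat_index[OF j i] rotation_mat_index[OF j i'(1)]
      by auto
  qed
qed

lemma map_rotation_mat_unitary:
  "map_mat complex_of_real (rotation_mat n \<theta>) \<in> unitary_mats n"
proof -
  define R where "R = map_mat complex_of_real (rotation_mat n \<theta>)"
  have R: "R \<in> carrier_mat n n" by (simp add: R_def rotation_mat_def)
  have Rij: "R $$ (i, j) = complex_of_real (rotation_mat n \<theta> $$ (i, j))" if "i < n" "j < n" for i j
    using that by (simp add: R_def rotation_mat_def)
  have "R * mat_adjoint R = 1\<^sub>m n"
  proof (rule eq_matI)
    fix i j assume "i < dim_row (1\<^sub>m n)" "j < dim_col (1\<^sub>m n)"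
    then have ij: "i < n" "j < n" by auto
    then have "(R * mat_adjoint R) $$ (i, j)
        = complex_of_real (\<Sum>r<n. 1 * rotation_mat n \<theta> $$ (j, r) * rotation_mat n \<theta> $$ (i, r))"
      using R by (subst index_mult_mat_sum[of _ n n _ n]) (auto simp: Rij mult.commute)
    then show "(R * mat_adjoint R) $$ (i, j) = 1\<^sub>m n $$ (i, j)"
      unfolding rotation_mat_gram[OF ij, of "\<lambda>_. 1"] using ij by (auto simp flip: of_real_add)
  qed (use R in auto)
  then have "mat_adjoint R \<in> unitary_mats n" using R by (simp add: unitary_mats_iff)
  from unitary_mats_adjoint[OF this] show ?thesis by (simp add: R_def)
qed

text \<open>\<open>S\<close> couples only mirror indices, and commuting with \<open>diag(l)\<close>
  multiplies entries by \<open>l i - l j\<close>, which clears the diagonal. The commutator is thus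
  antidiagonal; reversing its columns leaves \<open>half_gap_prod\<close> on the diagonal, up to
  signs.\<close>

lemma uinorm_commutator_rotation:
  assumes N: "unitarily_invariant_norm n N"
  shows "N (mat_commutator (rdiag n l)
      (spectral_mat n (map_mat complex_of_real (rotation_mat n (pi / 4))) d)) = N (rdiag n (half_gap_prod n l d))"
proof -
  define R where "R = map_mat complex_of_real (rotation_mat n (pi / 4))"
  define S where "S = spectral_mat n R d"
  define M where "M = mat_commutator (rdiag n l) S"
  define p where "p i = n - 1 - i" for i
  have R: "R \<in> carrier_mat n n" by (simp add: R_def rotation_mat_def)
  have S: "S \<in> carrier_mat n n" unfolding S_def by (rule spectral_mat_carrier[OF R])
  have M: "M \<in> carrier_mat n n" unfolding M_def by (intro mat_commutator_carrier S rdiag_carrier)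
  have Rij: "R $$ (i, j) = complex_of_real (rotation_mat n (pi / 4) $$ (i, j))" if "i < n" "j < n" for i j
    using that by (simp add: R_def rotation_mat_def)
  have p: "bij_betw p {..<n} {..<n}"
    by (rule bij_betw_byWitness[of _ p]) (auto simp: p_def)
  have pp: "p i < n" "p (p i) = i" if "i < n" for i using that by (auto simp: p_def)
  \<comment> \<open>The angle pi/4 gives \<open>cos sin\<close> its largest value.\<close>
  have cs: "cos (pi / 4) * sin (pi / 4) = (1 / 2 :: real)" by (simp add: cos_45 sin_45)
  have Sij: "S $$ (i, j) = complex_of_real (\<Sum>r<n. d r * rotation_mat n (pi / 4) $$ (j, r) * rotation_mat n (pi / 4) $$ (i, r))"
    if "i < n" "j < n" for i j
    unfolding S_def spectral_mat_index[OF R that] using that by (simp add: Rij mult_ac)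
  have Mij: "M $$ (i, j) = complex_of_real (l i - l j) * S $$ (i, j)" if "i < n" "j < n" for i j
    using that S unfolding M_def mat_commutator_def rdiag_def mat_diag_mult_left[OF S] mat_diag_mult_right[OF S]
    by (simp add: algebra_simps)
  have "M * perm_mat n p
      = mat_diag n (\<lambda>i. complex_of_real (- rot_sign n i) * complex_of_real (half_gap_prod n l d i))"
  proof (rule eq_matI)
    fix i j
    assume "i < dim_row (mat_diag n (\<lambda>i. complex_of_real (- rot_sign n i) * complex_of_real (half_gap_prod n l d i)))"
      and "j < dim_col (mat_diag n (\<lambda>i. complex_of_real (- rot_sign n i) * complex_of_real (half_gap_prod n l d i)))"
    then have ij: "i < n" "j < n" by (auto simp: mat_diag_def)
    have MP: "(M * perm_mat n p) $$ (i, j) = complex_of_real (l i - l (p j)) * S $$ (i, p j)"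
      using ij pp M by (subst mult_perm_mat_index) (auto simp: Mij)
    show "(M * perm_mat n p) $$ (i, j)
        = mat_diag n (\<lambda>i. complex_of_real (- rot_sign n i) * complex_of_real (half_gap_prod n l d i)) $$ (i, j)"
    proof (cases "i = p j")
      \<comment> \<open>The left entry is a diagonal entry of \<open>M\<close>, hence 0. On the
        right \<open>i = j\<close> forces the central index, where the gap is 0.\<close>
      case True
      then show ?thesis using MP ij by (auto simp: mat_diag_def half_gap_prod_def p_def)
    next
      case False
      then have ne: "(p j = i) = False" by simp
      have iff: "p j = p i \<longleftrightarrow> i = j" using pp(2)[OF ij(1)] pp(2)[OF ij(2)] by metis
      have Sp: "S $$ (i, p j) = (if i = j then complex_of_real (rot_sign n i / 2 * (d (p i) - d i)) else 0)"
        unfolding Sij[OF ij(1) pp(1)[OF ij(2)]] rotation_mat_gram[OF ij(1) pp(1)[OF ij(2)]] cs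
        using ne iff by (simp only: p_def[symmetric] if_False) auto
      have hg: "half_gap_prod n l d i = (l i - l (p i)) * (d i - d (p i)) / 2"
        by (simp add: half_gap_prod_def p_def)
      show ?thesis
      proof (cases "i = j")
        case True
        have "(l i - l (p i)) * (rot_sign n i / 2 * (d (p i) - d i)) = - rot_sign n i * half_gap_prod n l d i"
          unfolding hg by (simp add: field_simps)
        then have "complex_of_real (l i - l (p i)) * complex_of_real (rot_sign n i / 2 * (d (p i) - d i))
          = complex_of_real (- rot_sign n i) * complex_of_real (half_gap_prod n l d i)"
          by (simp only: of_real_mult[symmetric])
        then show ?thesis unfolding MP Sp using True ij by (simp add: mat_diag_def)
      qed (use ij in \<open>simp add: MP Sp mat_diag_def\<close>)
    qed
  qed (use M in \<open>auto simp: mat_diag_def perm_mat_def\<close>)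
  moreover have "N (M * perm_mat n p) = N M"
    by (rule uinorm_unitary_right[OF N perm_mat_unitary[OF p] M])
  moreover have "N (mat_diag n (\<lambda>i. complex_of_real (- rot_sign n i) * complex_of_real (half_gap_prod n l d i)))
      = N (rdiag n (half_gap_prod n l d))"
    by (rule uinorm_diag_phase[OF N]) (simp add: rot_sign_def)
  ultimately show ?thesis by (simp add: M_def S_def R_def)
qed

text \<open>The norm of \<open>diag(half_gap_prod)\<close> bounds every competitor, after a
  permutation of the diagonal, and the rotation attains it, since the common conjugation by
  \<open>Q\<close> drops out.\<close>

theorem mainTheorem8:
  fixes n :: nat
    and A B Q V :: "complex mat"
    and l d :: "nat \<Rightarrow> real"
    and N :: "complex mat \<Rightarrow> real"
  assumes "A \<in> carrier_mat n n" and "hermitian_mat A"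
    and "B \<in> carrier_mat n n" and "hermitian_mat B"
    and "Q \<in> unitary_mats n" and "V \<in> unitary_mats n"
    and "A = Q * mat_diag n (\<lambda>i. complex_of_real (l i)) * mat_adjoint Q"
    and "B = V * mat_diag n (\<lambda>i. complex_of_real (d i)) * mat_adjoint V"
    and "\<forall>i j. i \<le> j \<and> j < n \<longrightarrow> l j \<le> l i"
    and "\<forall>i j. i \<le> j \<and> j < n \<longrightarrow> d j \<le> d i"
    and "unitarily_invariant_norm n N"
  shows "is_arg_max (\<lambda>U. N (mat_commutator A (U * B * mat_adjoint U)))
           (\<lambda>U. U \<in> unitary_mats n)
           (Q * map_mat complex_of_real (rotation_mat n (pi / 4)) * mat_adjoint V)"
proof -
  define R where "R = map_mat complex_of_real (rotation_mat n (pi / 4))"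
  define Z where "Z = Q * R * mat_adjoint V"
  have R: "R \<in> unitary_mats n" unfolding R_def by (rule map_rotation_mat_unitary)
  note Q = assms(5) and V = assms(6) and N = assms(11)
  note carr = unitary_mats_carrier[OF Q] unitary_mats_carrier[OF V] unitary_mats_carrier[OF R]
  have A: "A = spectral_mat n Q l" and B: "B = spectral_mat n V d"
    using assms(7,8) by (simp_all add: spectral_mat_def rdiag_def)
  have UB: "U * B * mat_adjoint U = spectral_mat n (U * V) d" if "U \<in> unitary_mats n" for U
    unfolding B spectral_mat_conj[OF unitary_mats_carrier[OF that] carr(2)] ..
  have Z: "Z \<in> unitary_mats n"
    unfolding Z_def by (intro unitary_mats_mult Q R unitary_mats_adjoint[OF V])
  \<comment> \<open>The adjoint of \<open>V\<close> in \<open>Z\<close> cancels the eigenbasis of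
    \<open>B\<close>, so conjugating \<open>B\<close> by \<open>Z\<close> gives the eigenbasis
    \<open>Q * R\<close>.\<close>
  have "Z * V = Q * (R * (mat_adjoint V * V))"
    unfolding Z_def using carr by (simp add: assoc_mult_mat[of _ n n _ n _ n] mult_carrier_mat[of _ n n])
  also have "mat_adjoint V * V = 1\<^sub>m n" using V by (simp add: unitary_mats_def)
  finally have ZV: "Z * V = Q * R" using carr by (simp add: right_mult_one_mat[of _ n n])
  have "mat_commutator A (Z * B * mat_adjoint Z)
      = Q * mat_commutator (rdiag n l) (spectral_mat n R d) * mat_adjoint Q"
    unfolding UB[OF Z] ZV A spectral_mat_conj[OF carr(1,3)] unfolding spectral_mat_def[of n Q l]
    by (rule mat_commutator_conj[OF Q rdiag_carrier spectral_mat_carrier[OF carr(3)]])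
  also have "N \<dots> = N (mat_commutator (rdiag n l) (spectral_mat n R d))"
    using carr mat_commutator_carrier[OF rdiag_carrier spectral_mat_carrier[OF carr(3)], of l d]
    by (simp add: uinorm_unitary_right[OF N unitary_mats_adjoint[OF Q]] uinorm_unitary_left[OF N Q]
      mult_carrier_mat[of _ n n])
  finally have NZ: "N (mat_commutator A (Z * B * mat_adjoint Z)) = N (rdiag n (half_gap_prod n l d))"
    unfolding R_def uinorm_commutator_rotation[OF N] .
  have "N (mat_commutator A (U * B * mat_adjoint U)) \<le> N (rdiag n (half_gap_prod n l d))"
    if U: "U \<in> unitary_mats n" for U
    unfolding UB[OF U] A uinorm_rdiag_half_gap_prod[OF N, of l d, symmetric]
    using assms(9,10) by (intro uinorm_commutator_spectral_le[OF N Q unitary_mats_mult[OF U V]]) auto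
  then have "N (mat_commutator A (U * B * mat_adjoint U)) \<le> N (mat_commutator A (Z * B * mat_adjoint Z))"
    if "U \<in> unitary_mats n" for U
    using that NZ by simp
  then show ?thesis
    using Z unfolding is_arg_max_def Z_def R_def by (auto simp: not_less)
qed

end
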